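(* Let $A$ be an $n$-by-$n$ complex matrix and $B$ an $m$-by-$m$ complex matrix. If $\|A\|=1$ and $w(A\otimes B)=w(B)$, then either $A$ has a unitary part, or $A$ is completely nonunitary and $W(B)$ is a circular disc centered at the origin.
   Context: $\|\cdot\|$ is the operator norm. $W(X)=\{\langle Xx,x\rangle : \|x\|=1\}$ is the numerical range and $w(X)=\max\{|z|: z\in W(X)\}$ the numerical radius of a square complex matrix $X$. $A\otimes B$ is the tensor (Kronecker) product. Any contraction $A$ (i.e. $\|A\|\le 1$) is unitarily similar to a direct sum $U\oplus A'$ with $U$ unitary (the unitary part, possibly absent) and $A'$ completely nonunitary (possibly absent), meaning that $A'$ is not unitarily similar to any direct sum with a (nonzero-size) unitary summand (in particular, $A'$ itself is not unitary). "$A$ has a unitary part" means that $U$ is present, i.e. of size at least 1. A circular disc centered at the origin is a set $\{z\in\mathbb{C}: |z|\le r\}$ with $r\ge 0$ (the degenerate case $r=0$ is allowed). *)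

theory Defs
  imports "Jordan_Normal_Form.Schur_Decomposition"
begin

(* The scalar product v \<bullet>c w conjugates its second argument, so the inner product of X x and x
   is (X *\<^sub>v x) \<bullet>c x. *)

definition euclidean_norm :: "complex vec \<Rightarrow> real" where
  "euclidean_norm x = sqrt (Re (x \<bullet>c x))"

definition unit_sphere :: "nat \<Rightarrow> complex vec set" where
  "unit_sphere n = {x \<in> carrier_vec n. euclidean_norm x = 1}"

(* The suprema in operator_norm and numerical_radius are maxima, by compactness of the unit sphere,
   for matrices of size at least 1; for the empty matrix both values are unspecified. *)

definition operator_norm :: "complex mat \<Rightarrow> real" where
  "operator_norm X = (SUP x \<in> unit_sphere (dim_col X). euclidean_norm (X *\<^sub>v x))"

definition numerical_range :: "complex mat \<Rightarrow> complex set" where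
  "numerical_range X = {(X *\<^sub>v x) \<bullet>c x | x. x \<in> unit_sphere (dim_col X)}"

definition numerical_radius :: "complex mat \<Rightarrow> real" where
  "numerical_radius X = (SUP z \<in> numerical_range X. cmod z)"

definition kronecker_product :: "complex mat \<Rightarrow> complex mat \<Rightarrow> complex mat" where
  "kronecker_product A B =
     mat (dim_row A * dim_row B) (dim_col A * dim_col B)
       (\<lambda>(i, j). A $$ (i div dim_row B, j div dim_col B) * B $$ (i mod dim_row B, j mod dim_col B))"

definition unitary_mat :: "complex mat \<Rightarrow> bool" where
  "unitary_mat U \<longleftrightarrow> square_mat U \<and>
     mat_adjoint U * U = 1\<^sub>m (dim_row U) \<and> U * mat_adjoint U = 1\<^sub>m (dim_row U)"

definition unitarily_similar :: "complex mat \<Rightarrow> complex mat \<Rightarrow> bool" where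
  "unitarily_similar A B \<longleftrightarrow> (\<exists>P. unitary_mat P \<and> similar_mat_wit A B P (mat_adjoint P))"

(* The direct sum of U and C is diag_block_mat [U, C].  An absent summand is a 0-by-0 matrix;
   the 0-by-0 matrix is completely nonunitary under this definition. *)

definition completely_nonunitary :: "complex mat \<Rightarrow> bool" where
  "completely_nonunitary A \<longleftrightarrow>
     \<not> (\<exists>U C. unitary_mat U \<and> dim_row U \<ge> 1 \<and> square_mat C \<and>
          unitarily_similar A (diag_block_mat [U, C]))"

definition has_unitary_part :: "complex mat \<Rightarrow> bool" where
  "has_unitary_part A \<longleftrightarrow>
     (\<exists>U A'. unitary_mat U \<and> dim_row U \<ge> 1 \<and> square_mat A' \<and> completely_nonunitary A' \<and>
          unitarily_similar A (diag_block_mat [U, A']))"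

definition circular_disc_at_origin :: "complex set \<Rightarrow> bool" where
  "circular_disc_at_origin S \<longleftrightarrow> (\<exists>r\<ge>0. S = {z. cmod z \<le> r})"

end

theory Submission
  imports Defs "Jordan_Normal_Form.Spectral_Radius" "HOL-Library.Function_Algebras"
    "HOL-Analysis.Function_Topology" "HOL-Computational_Algebra.Polynomial_FPS"
begin

text \<open>
  Let \<open>A\<close> be completely nonunitary and let a unit vector \<open>x\<close> attain \<open>w(A \<otimes> B) = w(B) = w\<close>, after a
  rotation with real value \<open>w\<close>.  A unimodular eigenvalue of a contraction splits off as a unitary
  summand, so \<open>A\<close> has spectral radius below 1 and \<open>A\<^sup>kx \<rightarrow> 0\<close>.  Put \<open>D = I - A\<^sup>*A \<ge> 0\<close>.  Averaging over roots
  of unity gives \<open>Re \<Sum>\<langle>DBh\<^bsub>k+1\<^esub>, h\<^bsub>k\<^esub>\<rangle> \<le> w \<Sum>\<langle>Dh\<^bsub>k\<^esub>, h\<^bsub>k\<^esub>\<rangle>\<close> for finite sequences \<open>h\<close>, and by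
  telescoping the sequence \<open>0, x, Ax, A\<^sup>2x, \<dots>\<close> gives equality in the limit.  The first variation there is the recurrence
  \<open>2wG\<^bsub>k\<^esub> = BG\<^bsub>k+1\<^esub> + B\<^sup>*G\<^bsub>k-1\<^esub>\<close> for \<open>G\<^bsub>k\<^esub> = Dh\<^bsub>k\<^esub>\<close>.  Hence the generating function of \<open>G\<close> is a nonzero formal
  power series solution of \<open>(B - 2wz + z\<^sup>2B\<^sup>*)H(z) = 0\<close>, so \<open>det (B - 2wz + z\<^sup>2B\<^sup>*)\<close> vanishes identically.  For
  \<open>|z| = 1\<close> a kernel vector \<open>y\<close> satisfies \<open>\<langle>By, y\<rangle> = wz|y|\<^sup>2\<close>: the whole circle of radius \<open>w\<close> lies in
  \<open>W(B)\<close>, and so does the disc by convexity.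
\<close>

subsection \<open>Semi-inner products\<close>

lemma convex_bounded_seq_le:
  fixes e :: "nat \<Rightarrow> real"
  assumes convex: "\<And>k. 2 * e (Suc k) \<le> e k + e (Suc (Suc k))" and bounded: "\<And>k. e k \<le> M"
  shows "e 1 \<le> e 0"
proof (rule ccontr)
  assume "\<not> e 1 \<le> e 0"
  then have d: "e 1 - e 0 > 0" by simp
  \<comment> \<open>Convexity makes the increments nondecreasing, so a positive first one forces
    linear growth past \<open>M\<close>.\<close>
  have slope: "e (Suc k) - e k \<ge> e 1 - e 0" for k
  proof (induction k)
    case (Suc k)
    with convex[of k] show ?case by simp
  qed simp
  have growth: "e k \<ge> e 0 + real k * (e 1 - e 0)" for k
  proof (induction k)
    case (Suc k)
    with slope[of k] show ?case by (simp add: algebra_simps)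
  qed simp
  obtain k where "real k * (e 1 - e 0) > M - e 0"
    using reals_Archimedean3[OF d] by blast
  with growth[of k] bounded[of k] show False by simp
qed

text \<open>A geometric sum: its ratio \<open>c\<close> is an \<open>N\<close>-th root of unity and
  equals 1 only if \<open>N\<close> divides \<open>a - b\<close>, which the bounds on
  \<open>a\<close> and \<open>b\<close> restrict to \<open>a = b\<close>.\<close>

lemma root_of_unity_orthogonality:
  assumes "a < N" "b < N"
  shows "(\<Sum>j<N. cis (2 * pi / N) ^ (j * a) * cnj (cis (2 * pi / N)) ^ (j * b)) =
    (if a = b then of_nat N else 0)"
proof -
  define c where "c = cis (2 * pi * (real a - real b) / N)"
  have N: "real N > 0" using assms by simp
  have term_eq: "cis (2 * pi / N) ^ (j * a) * cnj (cis (2 * pi / N)) ^ (j * b) = c ^ j" for j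
    unfolding c_def cis_cnj by (simp add: Complex.DeMoivre cis_mult field_simps diff_divide_distrib)
  have "c ^ N = 1"
  proof -
    have "c ^ N = cis (2 * pi * of_int (int a - int b))"
      using N by (simp add: c_def Complex.DeMoivre)
    then show ?thesis by (simp add: cis_multiple_2pi)
  qed
  moreover have "c \<noteq> 1" if "a \<noteq> b"
  proof
    assume "c = 1"
    then have "cos (2 * pi * (real a - real b) / N) = 1"
      by (simp add: c_def complex_eq_iff)
    then obtain x :: int where "2 * pi * (real a - real b) / N = of_int x * 2 * pi"
      unfolding cos_one_2pi_int by blast
    then have "2 * pi * (real a - real b - of_int x * N) = 0" using N by (simp add: field_simps)
    then have "real a - real b = of_int x * N" by simp
    then have "real_of_int (int a - int b) = real_of_int (x * int N)" by simp
    then have "int a - int b = x * int N" by (simp only: of_int_eq_iff)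
    then have "int N dvd int a - int b" by simp
    then have "int N \<le> \<bar>int a - int b\<bar>"
      using dvd_imp_le_int[of "int a - int b" "int N"] that by simp
    with assms show False by linarith
  qed
  moreover have "(\<Sum>j<N. c ^ j) = (if c = 1 then of_nat N else (1 - c ^ N) / (1 - c))"
    by (rule sum_gp_strict)
  ultimately show ?thesis
    unfolding term_eq by (auto simp: c_def)
qed

text \<open>Positivity without definiteness: the forms \<open>defect\<close> and \<open>q\<close>
  below may vanish on nonzero vectors, and \<open>cinner\<close> ignores coordinates outside its
  index set.\<close>

locale semi_inner_product =
  fixes scale :: "complex \<Rightarrow> 'v::ab_group_add \<Rightarrow> 'v" and ip :: "'v \<Rightarrow> 'v \<Rightarrow> complex"
  assumes ip_add: "ip (x + y) z = ip x z + ip y z"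
    and ip_scale: "ip (scale c x) z = c * ip x z"
    and ip_cnj: "cnj (ip x y) = ip y x"
    and ip_self_nonneg: "0 \<le> Re (ip x x)"
begin

lemma ip_add_right: "ip z (x + y) = ip z x + ip z y"
  using arg_cong[OF ip_add[of x y z], of cnj] by (simp add: ip_cnj)

lemma ip_scale_right: "ip z (scale c x) = cnj c * ip z x"
  using arg_cong[OF ip_scale[of c x z], of cnj] by (simp add: ip_cnj)

lemma ip_zero [simp]: "ip 0 z = 0" "ip z 0 = 0"
  using ip_add[of 0 0 z] ip_add_right[of z 0 0] by auto

lemma ip_diff: "ip (x - y) z = ip x z - ip y z"
  using ip_add[of "x - y" y z] by (simp add: algebra_simps)

lemma ip_diff_right: "ip z (x - y) = ip z x - ip z y"
  using ip_add_right[of z "x - y" y] by (simp add: algebra_simps)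

lemma ip_sum: "ip (\<Sum>i\<in>S. f i) z = (\<Sum>i\<in>S. ip (f i) z)"
  by (induction S rule: infinite_finite_induct) (auto simp: ip_add)

lemma ip_sum_right: "ip z (\<Sum>i\<in>S. f i) = (\<Sum>i\<in>S. ip z (f i))"
  by (induction S rule: infinite_finite_induct) (auto simp: ip_add_right)

lemma Im_ip_self [simp]: "Im (ip x x) = 0"
  using arg_cong[OF ip_cnj[of x x], of Im] by simp

lemma Re_ip_commute: "Re (ip x y) = Re (ip y x)"
  using arg_cong[OF ip_cnj[of x y], of Re] by simp

text \<open>Expand \<open>ip (x - y) (x - y)\<close>, which is nonnegative. This stands in for the
  Cauchy-Schwarz inequality below.\<close>

lemma Re_ip_le: "2 * Re (ip x y) \<le> Re (ip x x) + Re (ip y y)"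
  using ip_self_nonneg[of "x - y"] Re_ip_commute[of x y] by (simp add: ip_diff ip_diff_right)

text \<open>The form \<open>x + scale (- 1) y\<close> is used because the locale has no law
  identifying \<open>scale (- 1) y\<close> with \<open>- y\<close>.\<close>

lemma polarization:
  assumes add: "\<And>x y. B (x + y) = B x + B y" and scl: "\<And>c x. B (scale c x) = scale c (B x)"
  shows "4 * ip (B x) y = ip (B (x + y)) (x + y) - ip (B (x + scale (- 1) y)) (x + scale (- 1) y)
    + \<i> * ip (B (x + scale \<i> y)) (x + scale \<i> y)
    - \<i> * ip (B (x + scale (- \<i>) y)) (x + scale (- \<i>) y)"
  by (simp add: add scl ip_add ip_add_right ip_scale ip_scale_right algebra_simps)

text \<open>After polarization the four squared norms add up by the parallelogram law. This controls
  the off-diagonal boundary term in \<open>shift_gap_orbit_tendsto\<close>.\<close>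

lemma numerical_bound_imp_bounded:
  assumes add: "\<And>x y. B (x + y) = B x + B y" and scl: "\<And>c x. B (scale c x) = scale c (B x)"
    and w: "\<And>y. cmod (ip (B y) y) \<le> w * Re (ip y y)"
  shows "cmod (ip (B x) y) \<le> w * (Re (ip x x) + Re (ip y y))"
proof -
  let ?e = "\<lambda>c. ip (B (x + scale c y)) (x + scale c y)"
  let ?n = "\<lambda>c. Re (ip (x + scale c y) (x + scale c y))"
  have "4 * ip (B x) y = ip (B (x + y)) (x + y) - ?e (- 1) + \<i> * ?e \<i> - \<i> * ?e (- \<i>)"
    by (rule polarization[OF add scl])
  then have "cmod (4 * ip (B x) y) \<le>
    cmod (ip (B (x + y)) (x + y)) + cmod (?e (- 1)) + cmod (\<i> * ?e \<i>) + cmod (\<i> * ?e (- \<i>))"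
    by (smt (verit) norm_triangle_ineq norm_triangle_ineq4)
  also have "\<dots> \<le> w * Re (ip (x + y) (x + y)) + w * ?n (- 1) + w * ?n \<i> + w * ?n (- \<i>)"
    using w[of "x + y"] w[of "x + scale (- 1) y"] w[of "x + scale \<i> y"] w[of "x + scale (- \<i>) y"]
    by (simp add: norm_mult)
  also have "\<dots> = 4 * w * (Re (ip x x) + Re (ip y y))"
    by (simp add: ip_add ip_add_right ip_scale ip_scale_right algebra_simps)
  finally show ?thesis by (simp add: norm_mult)
qed

text \<open>Since \<open>ip (A' x) (A' x) = ip (A (A' x)) x\<close>, \<open>Re_ip_le\<close> and
  contractivity give 2|A'x|^2 \<le> |A'x|^2 + |x|^2.\<close>

lemma adjoint_contraction:
  assumes adj: "\<And>x y. ip (A x) y = ip x (A' y)"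
    and contraction: "\<And>x. Re (ip (A x) (A x)) \<le> Re (ip x x)"
  shows "Re (ip (A' x) (A' x)) \<le> Re (ip x x)"
  using Re_ip_le[of "A (A' x)" x] contraction[of "A' x"] adj[of "A' x" x] by simp

text \<open>The numbers \<open>\<langle>(A'A)\<^sup>k y, y\<rangle>\<close> form a convex sequence, and a bounded convex sequence cannot
  start with an increase.\<close>

lemma contraction_of_bounded_powers:
  assumes adj: "\<And>x y. ip (A x) y = ip x (A' y)"
    and bound: "\<And>k. Re (ip (((A' \<circ> A) ^^ k) y) (((A' \<circ> A) ^^ k) y)) \<le> M"
      "\<And>k. Re (ip (A (((A' \<circ> A) ^^ k) y)) (A (((A' \<circ> A) ^^ k) y))) \<le> M"
  shows "Re (ip (A y) (A y)) \<le> Re (ip y y)"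
proof -
  \<comment> \<open>The sequence \<open>t\<close> is y, Ay, A'Ay, AA'Ay, ..., so that
    \<open>ip (t k) (t k)\<close> is the number \<langle>(A'A)^k y, y\<rangle>.\<close>
  define t where "t k = (if even k then ((A' \<circ> A) ^^ (k div 2)) y
    else A (((A' \<circ> A) ^^ (k div 2)) y))" for k
  have adj': "ip (A' x) z = ip x (A z)" for x z
    using arg_cong[OF adj[of z x], of cnj] by (simp add: ip_cnj)
  \<comment> \<open>Moving the outermost operator of one factor to the other side pairs the two
    neighbours of \<open>t (Suc k)\<close>; \<open>Re_ip_le\<close> then gives convexity.\<close>
  have step: "ip (t (Suc k)) (t (Suc k)) = ip (t k) (t (Suc (Suc k)))" for k
  proof (cases "even k")
    case True
    then show ?thesis by (simp add: t_def adj)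
  next
    case False
    then show ?thesis by (simp add: t_def adj')
  qed
  have "Re (ip (t 1) (t 1)) \<le> Re (ip (t 0) (t 0))"
  proof (rule convex_bounded_seq_le)
    show "2 * Re (ip (t (Suc k)) (t (Suc k))) \<le> Re (ip (t k) (t k)) +
      Re (ip (t (Suc (Suc k))) (t (Suc (Suc k))))" for k
      unfolding step[of k] by (rule Re_ip_le)
    show "Re (ip (t k) (t k)) \<le> M" for k
      using bound by (simp add: t_def)
  qed
  then show ?thesis by (simp add: t_def)
qed

text \<open>\<open>y\<close> is a discrete Fourier transform of \<open>h\<close>; orthogonality
  leaves the diagonal for \<open>c = 0\<close> and the first off-diagonal for \<open>c = 1\<close>.
  With \<open>K + 2\<close> nodes all indices \<open>k\<close> and \<open>l + c\<close> stay below
  the order of \<open>z\<close>, so nothing wraps around.\<close>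

lemma fourier_average:
  fixes K :: nat and h :: "nat \<Rightarrow> 'v"
  assumes add: "\<And>x y. B (x + y) = B x + B y" and scl: "\<And>c x. B (scale c x) = scale c (B x)"
    and "c \<le> 1"
  defines "z \<equiv> cis (2 * pi / real (K + 2))"
  defines "y \<equiv> \<lambda>j. \<Sum>k\<le>K. scale (z ^ (j * k)) (h k)"
  shows "(\<Sum>j<K + 2. cnj (z ^ j) ^ c * ip (B (y j)) (y j)) =
    of_nat (K + 2) * (\<Sum>k\<le>K. \<Sum>l\<le>K. if k = l + c then ip (B (h k)) (h l) else 0)"
proof -
  have B_zero: "B 0 = 0" using add[of 0 0] by simp
  have B_sum: "B (\<Sum>i\<in>S. f i) = (\<Sum>i\<in>S. B (f i))" for f :: "nat \<Rightarrow> 'v" and S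
    by (induction S rule: infinite_finite_induct) (auto simp: add B_zero)
  have "(\<Sum>j<K + 2. cnj (z ^ j) ^ c * ip (B (y j)) (y j)) =
    (\<Sum>j<K + 2. \<Sum>k\<le>K. \<Sum>l\<le>K. z ^ (j * k) * cnj z ^ (j * (l + c)) * ip (B (h k)) (h l))"
    unfolding y_def B_sum ip_sum ip_sum_right scl ip_scale ip_scale_right sum_distrib_left
    by (subst sum.swap, intro sum.cong refl)
      (simp add: power_add power_mult [symmetric] distrib_left mult_ac)
  also have "\<dots> = (\<Sum>k\<le>K. \<Sum>l\<le>K. (\<Sum>j<K + 2. z ^ (j * k) * cnj z ^ (j * (l + c))) *
    ip (B (h k)) (h l))"
    unfolding sum_distrib_right
    by (subst sum.swap, rule sum.cong[OF refl], rule sum.swap)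
  also have "\<dots> = (\<Sum>k\<le>K. \<Sum>l\<le>K. of_nat (K + 2) * (if k = l + c then ip (B (h k)) (h l) else 0))"
  proof (intro sum.cong refl)
    fix k l assume "k \<in> {..K}" "l \<in> {..K}"
    with \<open>c \<le> 1\<close> have "k < K + 2" "l + c < K + 2" by auto
    then show "(\<Sum>j<K + 2. z ^ (j * k) * cnj z ^ (j * (l + c))) * ip (B (h k)) (h l) =
      of_nat (K + 2) * (if k = l + c then ip (B (h k)) (h l) else 0)"
      unfolding z_def by (subst root_of_unity_orthogonality) auto
  qed
  finally show ?thesis by (simp add: sum_distrib_left)
qed

text \<open>The numerical bound is applied to each Fourier vector \<open>y j\<close> with
  \<open>u = cnj (z ^ j)\<close> and summed over \<open>j\<close>. Averaging with
  \<open>c = 1\<close> produces the shifted sum, and with \<open>c = 0\<close> and the identity for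
  \<open>B\<close> the sum of squares.\<close>

lemma shift_inequality:
  fixes h :: "nat \<Rightarrow> 'v"
  assumes add: "\<And>x y. B (x + y) = B x + B y" and scl: "\<And>c x. B (scale c x) = scale c (B x)"
    and w: "\<And>u y. cmod u = 1 \<Longrightarrow> Re (u * ip (B y) y) \<le> w * Re (ip y y)"
  shows "Re (\<Sum>k<K. ip (B (h (Suc k))) (h k)) \<le> w * (\<Sum>k\<le>K. Re (ip (h k) (h k)))"
proof -
  define z where "z = cis (2 * pi / real (K + 2))"
  define y where "y j = (\<Sum>k\<le>K. scale (z ^ (j * k)) (h k))" for j
  have "(\<Sum>j<K + 2. cnj (z ^ j) * ip (B (y j)) (y j)) =
    of_nat (K + 2) * (\<Sum>k\<le>K. \<Sum>l\<le>K. if k = l + 1 then ip (B (h k)) (h l) else 0)"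
    using fourier_average[OF add scl, where c = 1 and K = K and h = h] by (simp add: z_def y_def)
  also have "(\<Sum>k\<le>K. \<Sum>l\<le>K. if k = l + 1 then ip (B (h k)) (h l) else 0) =
    (\<Sum>l\<le>K. if l < K then ip (B (h (Suc l))) (h l) else 0)"
    by (subst sum.swap, intro sum.cong refl) auto
  also have "\<dots> = (\<Sum>k<K. ip (B (h (Suc k))) (h k))"
    by (rule sum.mono_neutral_cong_right) auto
  finally have shift: "(\<Sum>j<K + 2. cnj (z ^ j) * ip (B (y j)) (y j)) =
    of_nat (K + 2) * (\<Sum>k<K. ip (B (h (Suc k))) (h k))" .
  have "(\<Sum>j<K + 2. ip (y j) (y j)) =
    of_nat (K + 2) * (\<Sum>k\<le>K. \<Sum>l\<le>K. if k = l then ip (h k) (h l) else 0)"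
    using fourier_average[where B = "\<lambda>x. x" and c = 0 and K = K and h = h] by (simp add: z_def y_def)
  then have norms: "(\<Sum>j<K + 2. ip (y j) (y j)) = of_nat (K + 2) * (\<Sum>k\<le>K. ip (h k) (h k))"
    by simp
  have "real (K + 2) * Re (\<Sum>k<K. ip (B (h (Suc k))) (h k)) =
    (\<Sum>j<K + 2. Re (cnj (z ^ j) * ip (B (y j)) (y j)))"
    unfolding Re_sum[symmetric] shift by simp
  also have "\<dots> \<le> (\<Sum>j<K + 2. w * Re (ip (y j) (y j)))"
    by (intro sum_mono w) (simp add: z_def norm_power)
  also have "\<dots> = w * Re (\<Sum>j<K + 2. ip (y j) (y j))"
    by (simp only: sum_distrib_left Re_sum)
  also have "\<dots> = real (K + 2) * (w * (\<Sum>k\<le>K. Re (ip (h k) (h k))))"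
    unfolding norms by simp
  finally show ?thesis by simp
qed

section \<open>Convexity of the numerical range\<close>

text \<open>Along the path from \<open>x\<close> to a unimodular multiple of \<open>y\<close>, a
  suitable phase keeps the affinely normalized values real, so the intermediate value theorem
  reaches \<open>t\<close>.\<close>

lemma toeplitz_hausdorff:
  assumes add: "\<And>x y. B (x + y) = B x + B y" and scl: "\<And>c x. B (scale c x) = scale c (B x)"
    and x: "ip x x = 1" and y: "ip y y = 1" and t: "0 \<le> t" "t \<le> 1"
  obtains z where "ip z z = 1" "ip (B z) z = of_real (1 - t) * ip (B x) x + of_real t * ip (B y) y"
proof (cases "ip (B x) x = ip (B y) y")
  case True
  then show ?thesis using that[of x] x by (simp add: algebra_simps)
next
  case False
  define a where "a = ip (B x) x"
  define d where "d = ip (B y) y - a"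
  have d: "d \<noteq> 0" using False by (simp add: d_def a_def)
  text \<open>The affine image of the form for which the two values to be joined are 0 and 1.\<close>
  define F where "F v v' = (ip (B v) v' - a * ip v v') / d" for v v'
  have F_add: "F (v + v') v'' = F v v'' + F v' v''" "F v'' (v + v') = F v'' v + F v'' v'"
    and F_scale: "F (scale c v) v' = c * F v v'" "F v (scale c v') = cnj c * F v v'" for v v' v'' c
    by (simp_all add: F_def add scl ip_add ip_add_right ip_scale ip_scale_right
        add_divide_distrib [symmetric] diff_divide_distrib [symmetric] algebra_simps)
  have Fx: "F x x = 0" and Fy: "F y y = 1"
    using x y d by (simp_all add: F_def a_def d_def)
  \<comment> \<open>The imaginary part of the cross term \<open>cnj u * F x y + u * F y x\<close> is
    \<open>Im (u * e)\<close>, so the phase must make \<open>u * e\<close> real.\<close>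
  define e where "e = F y x - cnj (F x y)"
  obtain u0 where u0: "cmod u0 = 1" "Im (u0 * e) = 0"
  proof (cases "e = 0")
    case False
    have "Im (cnj e / of_real (cmod e) * e) = 0"
      by (simp add: mult.commute)
    with False that[of "cnj e / of_real (cmod e)"] show ?thesis by (simp add: norm_divide)
  qed (use that[of 1] in simp)
  \<comment> \<open>A change of sign keeps \<open>u * e\<close> real; the sign is chosen so that
    \<open>Z s\<close> has positive norm on all of [0, 1].\<close>
  define u where "u = (if 0 \<le> Re (cnj u0 * ip x y) then u0 else - u0)"
  have u: "cmod u = 1" "Im (u * e) = 0" "0 \<le> Re (cnj u * ip x y)"
    using u0 by (auto simp: u_def)
  have uu: "u * cnj u = 1" using u(1) by (simp add: complex_norm_square [symmetric])
  define m where "m = Re (cnj u * F x y + u * F y x)"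
  have "Im (cnj u * F x y + u * F y x) = 0"
    using u(2) by (simp add: e_def algebra_simps)
  then have m: "cnj u * F x y + u * F y x = of_real m" by (simp add: m_def complex_eq_iff)
  define Z where "Z s = scale (of_real (1 - s)) x + scale (of_real s * u) y" for s
  define N where "N s = (1 - s)\<^sup>2 + s\<^sup>2 + 2 * s * (1 - s) * Re (cnj u * ip x y)" for s
  define f where "f s = s * (1 - s) * m + s\<^sup>2" for s
  have "F (Z s) (Z s) = of_real (s * (1 - s)) * (cnj u * F x y + u * F y x) + of_real (s\<^sup>2) * (u * cnj u)" for s
    by (simp add: Z_def F_add F_scale Fx Fy algebra_simps power2_eq_square)
  then have FZ: "F (Z s) (Z s) = of_real (f s)" for s
    unfolding m uu by (simp add: f_def)
  have "ip (Z s) (Z s) = of_real ((1 - s)\<^sup>2) + of_real (s\<^sup>2) * (u * cnj u) +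
    of_real (s * (1 - s)) * (cnj u * ip x y + cnj (cnj u * ip x y))" for s
    by (simp add: Z_def ip_add ip_add_right ip_scale ip_scale_right x y ip_cnj algebra_simps
        power2_eq_square)
  then have NZ: "ip (Z s) (Z s) = of_real (N s)" for s
    unfolding complex_add_cnj uu by (simp add: N_def algebra_simps)
  have N_pos: "0 < N s" if "0 \<le> s" "s \<le> 1" for s
  proof -
    have "0 < (1 - s)\<^sup>2 + s\<^sup>2"
      by (cases "s = 0") (auto intro: add_nonneg_pos)
    moreover have "0 \<le> 2 * s * (1 - s) * Re (cnj u * ip x y)"
      using that u(3) by (intro mult_nonneg_nonneg) auto
    ultimately show ?thesis by (simp add: N_def)
  qed
  \<comment> \<open>The endpoint values are \<open>- t\<close> and \<open>1 - t\<close>; multiplying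
    out \<open>N s\<close> avoids a quotient.\<close>
  have "\<exists>s\<ge>0. s \<le> 1 \<and> f s - t * N s = 0"
  proof (rule IVT')
    show "continuous_on {0..1} (\<lambda>s. f s - t * N s)"
      unfolding f_def N_def by (intro continuous_intros)
  qed (use t in \<open>auto simp: f_def N_def\<close>)
  then obtain s where s: "0 \<le> s" "s \<le> 1" "f s = t * N s" by auto
  define z where "z = scale (of_real (1 / sqrt (N s))) (Z s)"
  have N: "0 < N s" using N_pos s by simp
  then have "sqrt (N s) * sqrt (N s) = N s" by simp
  then have root: "of_real (1 / sqrt (N s)) * cnj (of_real (1 / sqrt (N s))) * of_real (N s) = (1::complex)"
    using N by (simp add: of_real_mult [symmetric] del: of_real_mult)
  have "ip z z = 1"
    using root by (simp only: z_def ip_scale ip_scale_right NZ mult_ac)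
  moreover have "F z z = of_real t"
  proof -
    have "F z z = of_real (1 / sqrt (N s)) * cnj (of_real (1 / sqrt (N s))) * of_real (N s) * of_real t"
      by (simp only: z_def F_scale FZ s of_real_mult mult_ac)
    then show ?thesis unfolding root by simp
  qed
  then have "ip (B z) z = a * ip z z + of_real t * d"
    using d by (simp add: F_def field_simps)
  ultimately have "ip (B z) z = of_real (1 - t) * ip (B x) x + of_real t * ip (B y) y"
    by (simp add: a_def d_def algebra_simps)
  with \<open>ip z z = 1\<close> show ?thesis by (rule that)
qed

end

subsection \<open>The extremal orbit of a contraction\<close>

text \<open>The intended instance is \<open>A \<otimes> I\<close> with its adjoint and
  \<open>I \<otimes> B\<close> on the tensor product. An adjoint of \<open>B\<close> gets no name
  here: \<open>B\<close> is moved to the second argument instead.\<close>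

locale commuting_contraction = semi_inner_product scale ip
  for scale :: "complex \<Rightarrow> 'v::ab_group_add \<Rightarrow> 'v" and ip +
  fixes A A' B :: "'v \<Rightarrow> 'v" and w :: real
  assumes A_add: "A (x + y) = A x + A y" and A_scale: "A (scale c x) = scale c (A x)"
    and B_add: "B (x + y) = B x + B y" and B_scale: "B (scale c x) = scale c (B x)"
    and adjoint: "ip (A x) y = ip x (A' y)"
    and contraction: "Re (ip (A x) (A x)) \<le> Re (ip x x)"
    and A_B: "A (B x) = B (A x)" and A'_B: "A' (B x) = B (A' x)"
    and w_nonneg: "0 \<le> w"
    and numerical_bound: "cmod (ip (B x) x) \<le> w * Re (ip x x)"
begin

text \<open>The form of the defect operator I - A'A, nonnegative because \<open>A\<close> is a
  contraction.\<close>

definition defect :: "'v \<Rightarrow> 'v \<Rightarrow> complex" where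
  "defect x y = ip x y - ip (A x) (A y)"

lemma semi_inner_product_defect: "semi_inner_product scale defect"
  by unfold_locales
    (auto simp: defect_def A_add A_scale ip_add ip_scale ip_cnj contraction algebra_simps)

sublocale defect: semi_inner_product scale defect
  by (rule semi_inner_product_defect)

lemma Re_rotated_numerical_bound:
  assumes "cmod u = 1"
  shows "Re (u * ip (B x) x) \<le> w * Re (ip x x)"
  using complex_Re_le_cmod[of "u * ip (B x) x"] numerical_bound[of x] assms
  by (simp add: norm_mult)

text \<open>The form \<open>q\<close> of 2w - 2 Re(uB) is nonnegative, and \<open>A'\<close> is an
  adjoint of \<open>A\<close> for it as well, because \<open>B\<close> commutes with both. Powers of
  A'A stay bounded in \<open>q\<close>, so \<open>A\<close> is also a contraction for
  \<open>q\<close>; rearranged, this is the claim.\<close>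

lemma defect_numerical_bound:
  assumes u: "cmod u = 1"
  shows "Re (u * defect (B x) x) \<le> w * Re (defect x x)"
proof -
  define q where "q x y = 2 * of_real w * ip x y - u * ip (B x) y - cnj u * ip x (B y)" for x y
  have Re_q: "Re (q x x) = 2 * (w * Re (ip x x) - Re (u * ip (B x) x))" for x
  proof -
    have "Re (cnj u * ip x (B x)) = Re (u * ip (B x) x)"
      by (subst ip_cnj[of "B x" x, symmetric]) simp
    then show ?thesis by (simp add: q_def)
  qed
  interpret q: semi_inner_product scale q
  proof
    show "0 \<le> Re (q x x)" for x
      using Re_rotated_numerical_bound[OF u, of x] by (simp add: Re_q)
  qed (simp_all add: q_def B_add B_scale ip_add ip_add_right ip_scale ip_scale_right ip_cnj
      algebra_simps)
  \<comment> \<open>The opposite rotation \<open>- u\<close> bounds \<open>q\<close> from above by a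
    multiple of \<open>ip\<close>.\<close>
  have q_le: "Re (q y y) \<le> 4 * w * Re (ip y y)" for y
    using Re_rotated_numerical_bound[of "- u" y] u by (simp add: Re_q)
  have A'_le: "Re (ip (A' y) (A' y)) \<le> Re (ip y y)" for y
    using adjoint contraction by (rule adjoint_contraction)
  have powers_le: "Re (ip (((A' \<circ> A) ^^ k) x) (((A' \<circ> A) ^^ k) x)) \<le> Re (ip x x)" for k
  proof (induction k)
    case (Suc k)
    have step: "((A' \<circ> A) ^^ Suc k) x = A' (A (((A' \<circ> A) ^^ k) x))" by simp
    show ?case
      unfolding step using Suc contraction[of "((A' \<circ> A) ^^ k) x"] A'_le[of "A (((A' \<circ> A) ^^ k) x)"] by linarith
  qed simp
  have "Re (q (A x) (A x)) \<le> Re (q x x)"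
  proof (rule q.contraction_of_bounded_powers)
    show "q (A y) z = q y (A' z)" for y z
      by (simp add: q_def adjoint A_B[symmetric] A'_B[symmetric])
    show "Re (q (((A' \<circ> A) ^^ k) x) (((A' \<circ> A) ^^ k) x)) \<le> 4 * w * Re (ip x x)" for k
      by (rule order_trans[OF q_le mult_left_mono[OF powers_le]]) (simp add: w_nonneg)
    show "Re (q (A (((A' \<circ> A) ^^ k) x)) (A (((A' \<circ> A) ^^ k) x))) \<le> 4 * w * Re (ip x x)" for k
      by (rule order_trans[OF q_le mult_left_mono[OF order_trans[OF contraction powers_le]]])
        (simp add: w_nonneg)
  qed
  moreover have "2 * (a - b) \<le> 2 * (c - d) \<Longrightarrow> d - b \<le> c - a" for a b c d :: real
    by simp
  ultimately have "Re (u * ip (B x) x) - Re (u * ip (B (A x)) (A x)) \<le>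
    w * Re (ip x x) - w * Re (ip (A x) (A x))"
    unfolding Re_q by blast
  then show ?thesis
    by (simp only: defect_def A_B right_diff_distrib minus_complex.simps)
qed

section \<open>Variation along the extremal orbit\<close>

text \<open>The leading zero admits a perturbation at index 0, where \<open>orbit_recurrence\<close>
  yields the initial equation \<open>defect (B x) v = 0\<close>.\<close>

definition orbit :: "'v \<Rightarrow> nat \<Rightarrow> 'v" where
  "orbit x k = (case k of 0 \<Rightarrow> 0 | Suc k \<Rightarrow> (A ^^ k) x)"

lemma orbit_simps [simp]: "orbit x 0 = 0" "orbit x (Suc k) = (A ^^ k) x"
  by (simp_all add: orbit_def)

text \<open>The slack in \<open>shift_inequality\<close> for the defect form.\<close>

definition shift_gap :: "(nat \<Rightarrow> 'v) \<Rightarrow> nat \<Rightarrow> real" where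
  "shift_gap h K = w * (\<Sum>k\<le>K. Re (defect (h k) (h k))) - Re (\<Sum>k<K. defect (B (h (Suc k))) (h k))"

lemma shift_gap_nonneg: "0 \<le> shift_gap h K"
  using defect.shift_inequality[of B w h K, OF B_add B_scale defect_numerical_bound]
  by (simp add: shift_gap_def)

text \<open>Both sums telescope, since \<open>defect\<close> compares consecutive powers of
  \<open>A\<close>. Extremality of \<open>x\<close> cancels the initial terms, and the final ones
  tend to 0 with the norms.\<close>

lemma shift_gap_orbit_tendsto:
  assumes extremal: "ip (B (A x)) x = of_real w * ip x x"
    and decay: "(\<lambda>k. Re (ip ((A ^^ k) x) ((A ^^ k) x))) \<longlonglongrightarrow> 0"
  shows "shift_gap (orbit x) \<longlonglongrightarrow> 0"
proof -
  define a where "a k = Re (ip ((A ^^ k) x) ((A ^^ k) x))" for k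
  define b where "b k = ip (B ((A ^^ Suc k) x)) ((A ^^ k) x)" for k
  have diag: "(\<Sum>k\<le>J. Re (defect ((A ^^ k) x) ((A ^^ k) x))) = a 0 - a (Suc J)" for J
    by (induction J) (simp_all add: a_def defect_def)
  have off: "(\<Sum>k<J. defect (B ((A ^^ Suc k) x)) ((A ^^ k) x)) = b 0 - b J" for J
    by (induction J) (simp_all add: b_def defect_def A_B)
  have "b 0 = of_real (w * a 0)"
    using extremal by (simp add: b_def a_def complex_eq_iff)
  \<comment> \<open>The zero entry contributes to neither sum, so both can start one index
    later.\<close>
  moreover have "shift_gap (orbit x) (Suc J) = w * (\<Sum>k\<le>J. Re (defect ((A ^^ k) x) ((A ^^ k) x)))
      - Re (\<Sum>k<J. defect (B ((A ^^ Suc k) x)) ((A ^^ k) x))" for J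
    unfolding shift_gap_def sum.atMost_Suc_shift sum.lessThan_Suc_shift orbit_simps by simp
  ultimately have gap: "shift_gap (orbit x) (Suc J) = - w * a (Suc J) + Re (b J)" for J
    unfolding diag off by (simp add: algebra_simps)
  have a: "a \<longlonglongrightarrow> 0" unfolding a_def by (rule decay)
  have a_Suc: "(\<lambda>J. a (Suc J)) \<longlonglongrightarrow> 0" using a by (rule LIMSEQ_Suc)
  have lim: "(\<lambda>J. w * (a (Suc J) + a J)) \<longlonglongrightarrow> 0"
    using tendsto_mult[OF tendsto_const[of w] tendsto_add[OF a_Suc a]] by simp
  have bound: "norm (b J) \<le> norm (w * (a (Suc J) + a J)) * 1" for J
    unfolding real_norm_def mult_1_right a_def b_def
    by (rule order_trans[OF numerical_bound_imp_bounded[OF B_add B_scale numerical_bound] abs_ge_self])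
  have "b \<longlonglongrightarrow> 0"
    by (rule tendsto_0_le[OF lim always_eventually[OF allI[OF bound]]])
  then have "(\<lambda>J. - w * a (Suc J) + Re (b J)) \<longlonglongrightarrow> - w * 0 + Re 0"
    by (intro tendsto_intros a_Suc)
  then show ?thesis
    by (intro LIMSEQ_imp_Suc[of "shift_gap (orbit x)"]) (simp add: gap)
qed

text \<open>The sequence \<open>0, x, Ax, A\<^sup>2x, \<dots>\<close> minimises the gap, so the first variation vanishes in each
  entry.\<close>

lemma orbit_recurrence:
  assumes extremal: "ip (B (A x)) x = of_real w * ip x x"
    and decay: "(\<lambda>k. Re (ip ((A ^^ k) x) ((A ^^ k) x))) \<longlonglongrightarrow> 0"
  shows "2 * of_real w * defect (orbit x i) v =
    defect (B (orbit x (Suc i))) v + (if i = 0 then 0 else defect (orbit x (i - 1)) (B v))"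
proof -
  define h where "h = orbit x"
  \<comment> \<open>\<open>Re (L v)\<close> is the linear part of the change of the gap when
    \<open>v\<close> is added to entry \<open>i\<close>; the last two terms come from the
    neighbouring entries.\<close>
  define L where "L v = 2 * of_real w * defect (h i) v - defect (B (h (Suc i))) v
    - (if i = 0 then 0 else defect (h (i - 1)) (B v))" for v
  have L_scale: "L (scale c v) = cnj c * L v" for c v
    by (simp add: L_def B_scale defect.ip_scale_right algebra_simps)
  have B_zero: "B 0 = 0" using B_add[of 0 0] by simp
  have variation: "0 \<le> Re (L v) + w * Re (defect v v)" for v
  proof -
    define p where "p k = h k + (if k = i then v else 0)" for k
    have diag: "Re (defect (p k) (p k)) = Re (defect (h k) (h k)) +
      (if k = i then 2 * Re (defect (h i) v) + Re (defect v v) else 0)" for k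
      using defect.Re_ip_commute[of v "h i"]
      by (simp add: p_def defect.ip_add defect.ip_add_right)
    have off: "defect (B (p (Suc k))) (p k) = defect (B (h (Suc k))) (h k) +
      (if k = i then defect (B (h (Suc i))) v else 0) +
      (if Suc k = i then defect (B v) (h k) else 0)" for k
      by (auto simp: p_def B_add B_zero defect.ip_add defect.ip_add_right)
    \<comment> \<open>For \<open>K > i\<close> all perturbed terms lie inside the sums; letting
      \<open>K\<close> grow then removes \<open>shift_gap h K\<close>.\<close>
    have "shift_gap p K = shift_gap h K + (Re (L v) + w * Re (defect v v))" if "i < K" for K
    proof -
      have "(\<Sum>k<K. if Suc k = i then defect (B v) (h k) else 0) =
        (if i = 0 then 0 else defect (B v) (h (i - 1)))"
        using that by (cases i) (auto simp: sum.delta)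
      moreover have "Re (defect (B v) (h (i - 1))) = Re (defect (h (i - 1)) (B v))"
        by (rule defect.Re_ip_commute)
      ultimately show ?thesis
        using that unfolding shift_gap_def diag off sum.distrib
        by (simp add: L_def sum.delta algebra_simps)
    qed
    then have "\<forall>\<^sub>F K in sequentially. 0 \<le> shift_gap h K + (Re (L v) + w * Re (defect v v))"
      using shift_gap_nonneg[of p] by (intro eventually_sequentiallyI[of "Suc i"]) (metis Suc_le_eq)
    moreover have "(\<lambda>K. shift_gap h K + (Re (L v) + w * Re (defect v v))) \<longlonglongrightarrow>
      0 + (Re (L v) + w * Re (defect v v))"
      unfolding h_def by (intro tendsto_intros shift_gap_orbit_tendsto extremal decay)
    ultimately show ?thesis
      using tendsto_lowerbound[OF _ _ sequentially_bot] by fastforce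
  qed
  have "L v = 0"
  proof -
    \<comment> \<open>As \<open>L\<close> is conjugate-linear, the multiple \<open>- t * L v\<close>
      of \<open>v\<close> has linear term - t |L v|^2 and quadratic term t^2 |L v|^2 W; with
      \<open>t * W < 1\<close> the former dominates.\<close>
    define W where "W = w * Re (defect v v)"
    have W: "0 \<le> W" unfolding W_def by (intro mult_nonneg_nonneg w_nonneg defect.ip_self_nonneg)
    define t where "t = 1 / (W + 1)"
    have t: "0 < t" "t * W < 1" using W by (simp_all add: t_def)
    have "0 \<le> Re (L (scale (- of_real t * L v) v)) +
      w * Re (defect (scale (- of_real t * L v) v) (scale (- of_real t * L v) v))"
      by (rule variation)
    also have "\<dots> = - t * (cmod (L v))\<^sup>2 + t\<^sup>2 * (cmod (L v))\<^sup>2 * W"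
    proof -
      have N: "L v * cnj (L v) = of_real ((cmod (L v))\<^sup>2)"
        by (rule complex_norm_square[symmetric])
      have "L (scale (- of_real t * L v) v) = of_real (- t) * (L v * cnj (L v))"
        by (simp add: L_scale algebra_simps)
      moreover have "defect (scale (- of_real t * L v) v) (scale (- of_real t * L v) v) =
        of_real (t\<^sup>2) * (L v * cnj (L v)) * defect v v"
        by (simp add: defect.ip_scale defect.ip_scale_right power2_eq_square algebra_simps)
      ultimately show ?thesis
        unfolding N W_def by (simp del: of_real_power)
    qed
    also have "\<dots> = - (t * (1 - t * W)) * (cmod (L v))\<^sup>2"
      by (simp add: power2_eq_square algebra_simps)
    finally have "(t * (1 - t * W)) * (cmod (L v))\<^sup>2 \<le> 0" by simp
    moreover have "0 < t * (1 - t * W)" using t by simp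
    ultimately have "(cmod (L v))\<^sup>2 \<le> 0"
      using mult_le_cancel_left_pos[of "t * (1 - t * W)" "(cmod (L v))\<^sup>2" 0] by simp
    then show ?thesis by simp
  qed
  then show ?thesis by (simp add: L_def h_def algebra_simps)
qed

end

subsection \<open>Unitary summands\<close>

lemma index_mat_adjoint [simp]:
  "i < dim_col M \<Longrightarrow> j < dim_row M \<Longrightarrow> mat_adjoint M $$ (i, j) = conjugate (M $$ (j, i))"
  by (simp add: mat_adjoint_def mat_of_rows_def)

lemma dim_mat_adjoint [simp]:
  "dim_row (mat_adjoint M) = dim_col M" "dim_col (mat_adjoint M) = dim_row M"
  by (simp_all add: mat_adjoint_def)

lemma mat_adjoint_carrier [simp]:
  "M \<in> carrier_mat n m \<Longrightarrow> mat_adjoint M \<in> carrier_mat m n"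
  by (rule carrier_matI) (simp_all only: dim_mat_adjoint carrier_matD)

lemma mat_adjoint_mult:
  fixes M N :: "complex mat"
  assumes "M \<in> carrier_mat n m" "N \<in> carrier_mat m k"
  shows "mat_adjoint (M * N) = mat_adjoint N * mat_adjoint M"
  by (rule eq_matI) (use assms in \<open>auto simp: scalar_prod_def mult.commute\<close>)

lemma adjoint_scalar_prod:
  fixes M :: "complex mat"
  assumes M: "M \<in> carrier_mat n m" and x: "x \<in> carrier_vec m" and y: "y \<in> carrier_vec n"
  shows "(M *\<^sub>v x) \<bullet>c y = x \<bullet>c (mat_adjoint M *\<^sub>v y)"
proof -
  have "(M *\<^sub>v x) \<bullet>c y = (\<Sum>i<n. \<Sum>j<m. M $$ (i, j) * x $ j * cnj (y $ i))"
    using assms by (auto simp: scalar_prod_def sum_distrib_right atLeast0LessThan intro!: sum.cong)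
  also have "\<dots> = (\<Sum>j<m. \<Sum>i<n. M $$ (i, j) * x $ j * cnj (y $ i))"
    by (rule sum.swap)
  also have "\<dots> = x \<bullet>c (mat_adjoint M *\<^sub>v y)"
    using assms by (auto simp: scalar_prod_def sum_distrib_left atLeast0LessThan mult_ac
        intro!: sum.cong)
  finally show ?thesis .
qed

lemma unitary_mat_mult:
  assumes "unitary_mat P" "unitary_mat Q" "dim_row P = dim_row Q"
  shows "unitary_mat (P * Q)"
proof -
  define n where "n = dim_row P"
  have P: "P \<in> carrier_mat n n" "mat_adjoint P * P = 1\<^sub>m n" "P * mat_adjoint P = 1\<^sub>m n"
    and Q: "Q \<in> carrier_mat n n" "mat_adjoint Q * Q = 1\<^sub>m n" "Q * mat_adjoint Q = 1\<^sub>m n"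
    using assms by (auto simp: unitary_mat_def n_def)
  have "mat_adjoint Q * mat_adjoint P * (P * Q) = mat_adjoint Q * (mat_adjoint P * P * Q)"
    using P(1) Q(1) by (simp add: assoc_mult_mat[of _ n n _ n _ n] mult_carrier_mat[of _ n n _ n])
  moreover have "P * Q * (mat_adjoint Q * mat_adjoint P) = P * (Q * mat_adjoint Q * mat_adjoint P)"
    using P(1) Q(1) by (simp add: assoc_mult_mat[of _ n n _ n _ n] mult_carrier_mat[of _ n n _ n])
  ultimately show ?thesis
    using P Q by (simp add: unitary_mat_def mat_adjoint_mult[OF P(1) Q(1)])
qed

lemma unitarily_similar_trans:
  assumes "unitarily_similar A B" "unitarily_similar B C"
  shows "unitarily_similar A C"
proof -
  obtain P Q where P: "unitary_mat P" "similar_mat_wit A B P (mat_adjoint P)"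
    and Q: "unitary_mat Q" "similar_mat_wit B C Q (mat_adjoint Q)"
    using assms unfolding unitarily_similar_def by blast
  define n where "n = dim_row A"
  note AB = similar_mat_witD[OF n_def P(2)]
  note BC = similar_mat_witD2[OF AB(5) Q(2)]
  have "unitary_mat (P * Q)"
    using unitary_mat_mult[OF P(1) Q(1)] AB BC by auto
  moreover have "similar_mat_wit A C (P * Q) (mat_adjoint (P * Q))"
    using similar_mat_wit_trans[OF P(2) Q(2)] mat_adjoint_mult[OF AB(6) BC(6)] by simp
  ultimately show ?thesis unfolding unitarily_similar_def by blast
qed

lemma diag_block_mat_two:
  "diag_block_mat [U, C] =
    four_block_mat U (0\<^sub>m (dim_row U) (dim_col C)) (0\<^sub>m (dim_row C) (dim_col U)) C"
  unfolding diag_block_mat.simps(2)[of U "[C]"] diag_block_mat_singleton Let_def ..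

lemma diag_block_mat_pair:
  assumes "U \<in> carrier_mat a a" "C \<in> carrier_mat b b"
  shows "diag_block_mat [U, C] = four_block_mat U (0\<^sub>m a b) (0\<^sub>m b a) C"
    and "diag_block_mat [U, C] \<in> carrier_mat (a + b) (a + b)"
  using assms by (auto simp: diag_block_mat_two simp del: diag_block_mat.simps)

lemma mat_adjoint_diag_block_pair:
  fixes U C :: "complex mat"
  assumes "U \<in> carrier_mat a a" "C \<in> carrier_mat b b"
  shows "mat_adjoint (diag_block_mat [U, C]) = diag_block_mat [mat_adjoint U, mat_adjoint C]"
  unfolding diag_block_mat_pair(1)[OF assms]
    diag_block_mat_pair(1)[OF assms[THEN mat_adjoint_carrier]]
  by (rule eq_matI) (use assms in \<open>auto simp: index_mat_four_block\<close>)

lemma unitary_diag_block_pair: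
  assumes "unitary_mat U" "unitary_mat C"
  shows "unitary_mat (diag_block_mat [U, C])"
proof -
  define a b where "a = dim_row U" and "b = dim_row C"
  have U: "U \<in> carrier_mat a a" "mat_adjoint U * U = 1\<^sub>m a" "U * mat_adjoint U = 1\<^sub>m a"
    and C: "C \<in> carrier_mat b b" "mat_adjoint C * C = 1\<^sub>m b" "C * mat_adjoint C = 1\<^sub>m b"
    using assms by (auto simp: unitary_mat_def a_def b_def)
  have one: "four_block_mat (1\<^sub>m a) (0\<^sub>m a b) (0\<^sub>m b a) (1\<^sub>m b) = (1\<^sub>m (a + b) :: complex mat)"
    by (rule eq_matI) auto
  note mult = mult_four_block_mat[where ?nr1.0 = a and ?nr2.0 = b and ?n1.0 = a and ?n2.0 = b
      and ?nc1.0 = a and ?nc2.0 = b]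
  have "mat_adjoint (diag_block_mat [U, C]) * diag_block_mat [U, C] = 1\<^sub>m (a + b)"
    unfolding mat_adjoint_diag_block_pair[OF U(1) C(1)]
    unfolding diag_block_mat_pair(1)[OF U(1) C(1)]
      diag_block_mat_pair(1)[OF U(1)[THEN mat_adjoint_carrier] C(1)[THEN mat_adjoint_carrier]]
    using U C by (subst mult) (auto simp: one)
  moreover have "diag_block_mat [U, C] * mat_adjoint (diag_block_mat [U, C]) = 1\<^sub>m (a + b)"
    unfolding mat_adjoint_diag_block_pair[OF U(1) C(1)]
    unfolding diag_block_mat_pair(1)[OF U(1) C(1)]
      diag_block_mat_pair(1)[OF U(1)[THEN mat_adjoint_carrier] C(1)[THEN mat_adjoint_carrier]]
    using U C by (subst mult) (auto simp: one)
  ultimately show ?thesis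
    using diag_block_mat_pair(2)[OF U(1) C(1)]
    by (simp add: unitary_mat_def carrier_matD del: diag_block_mat.simps)
qed

lemma unitary_one_mat: "unitary_mat (1\<^sub>m n)"
proof -
  have "mat_adjoint (1\<^sub>m n) = (1\<^sub>m n :: complex mat)"
    by (rule eq_matI) auto
  then show ?thesis by (simp add: unitary_mat_def)
qed

lemma unitarily_similar_diag_block_pair:
  assumes U: "square_mat U" and sim: "unitarily_similar C D"
  shows "unitarily_similar (diag_block_mat [U, C]) (diag_block_mat [U, D])"
proof -
  obtain P where P: "unitary_mat P" "similar_mat_wit C D P (mat_adjoint P)"
    using sim unfolding unitarily_similar_def by blast
  define a b where "a = dim_row U" and "b = dim_row C"
  have U: "U \<in> carrier_mat a a" using U by (auto simp: a_def)
  note CD = similar_mat_witD[OF b_def P(2)]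
  have one: "mat_adjoint (1\<^sub>m a) = (1\<^sub>m a :: complex mat)"
    by (rule eq_matI) auto
  have "similar_mat_wit U U (1\<^sub>m a) (mat_adjoint (1\<^sub>m a))"
    by (rule similar_mat_witI[of _ _ a]) (use U in \<open>auto simp: one\<close>)
  from similar_mat_wit_four_block[OF this P(2), of "0\<^sub>m a b" "0\<^sub>m a b" "0\<^sub>m b a" "0\<^sub>m b a" a b]
  have "similar_mat_wit (diag_block_mat [U, C]) (diag_block_mat [U, D])
    (diag_block_mat [1\<^sub>m a, P]) (mat_adjoint (diag_block_mat [1\<^sub>m a, P]))"
    unfolding mat_adjoint_diag_block_pair[OF one_carrier_mat CD(6)] one
    unfolding diag_block_mat_pair(1)[OF U CD(4)] diag_block_mat_pair(1)[OF U CD(5)]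
      diag_block_mat_pair(1)[OF one_carrier_mat CD(6)] diag_block_mat_pair(1)[OF one_carrier_mat CD(7)]
    using U CD(4-6) by simp
  with unitary_diag_block_pair[OF unitary_one_mat P(1)] show ?thesis
    unfolding unitarily_similar_def by blast
qed

lemma diag_block_mat_pair_assoc:
  "diag_block_mat [U, diag_block_mat [V, C]] = diag_block_mat [diag_block_mat [U, V], C]"
  unfolding diag_block_mat_two by (rule assoc_four_block_mat)

text \<open>\<open>has_unitary_part\<close> demands a completely nonunitary complement. While
  \<open>C\<close> is not one, a unitary summand of \<open>C\<close> is absorbed into
  \<open>U\<close>; the size of \<open>C\<close> drops, so this ends, if need be at the 0-by-0
  matrix.\<close>

lemma unitary_summand_imp_has_unitary_part:
  assumes "unitary_mat U" "dim_row U \<ge> 1" "square_mat C"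
    and "unitarily_similar A (diag_block_mat [U, C])"
  shows "has_unitary_part A"
  using assms
proof (induction "dim_row C" arbitrary: U C rule: less_induct)
  case less
  show ?case
  proof (cases "completely_nonunitary C")
    case True
    with less.prems show ?thesis unfolding has_unitary_part_def by blast
  next
    case False
    then obtain V D where V: "unitary_mat V" "dim_row V \<ge> 1" and D: "square_mat D"
      and sim: "unitarily_similar C (diag_block_mat [V, D])"
      unfolding completely_nonunitary_def by blast
    have "dim_row C = dim_row (diag_block_mat [V, D])"
      using sim similar_mat_witD[OF refl, of C "diag_block_mat [V, D]"]
      unfolding unitarily_similar_def by (metis carrier_matD(1))
    then have "dim_row D < dim_row C"
      using V(2) by (simp add: dim_diag_block_mat)
    moreover have "unitary_mat (diag_block_mat [U, V])"
      using less.prems(1) V(1) by (rule unitary_diag_block_pair)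
    moreover have "dim_row (diag_block_mat [U, V]) \<ge> 1"
      using V(2) by (simp add: dim_diag_block_mat)
    moreover have "square_mat U" using less.prems(1) by (simp add: unitary_mat_def)
    then have "unitarily_similar A (diag_block_mat [diag_block_mat [U, V], D])"
      using unitarily_similar_trans[OF less.prems(4) unitarily_similar_diag_block_pair[OF _ sim]]
      by (simp only: diag_block_mat_pair_assoc)
    ultimately show ?thesis using less.hyps D by blast
  qed
qed

lemma has_unitary_part_or_completely_nonunitary:
  "has_unitary_part A \<or> completely_nonunitary A"
  using unitary_summand_imp_has_unitary_part unfolding completely_nonunitary_def by blast

section \<open>Splitting off a unimodular eigenvalue\<close>

lemma cscalar_prod_self:
  fixes v :: "complex vec"
  shows "v \<bullet>c v = of_real (\<Sum>i<dim_vec v. (cmod (v $ i))\<^sup>2)"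
  by (simp add: scalar_prod_def atLeast0LessThan complex_norm_square del: of_real_power)

text \<open>Gram-Schmidt on a basis starting with \<open>v\<close> keeps \<open>v\<close> in front
  but does not normalize, so the vectors are divided by their norms \<open>r j\<close>;
  \<open>c\<close> is the reciprocal of the norm of \<open>v\<close>.\<close>

lemma unitary_completion:
  fixes v :: "complex vec"
  assumes v: "v \<in> carrier_vec n" "v \<noteq> 0\<^sub>v n"
  obtains P c where "P \<in> carrier_mat n n" "unitary_mat P" "col P 0 = c \<cdot>\<^sub>v v"
proof -
  interpret cof_vec_space n "TYPE(complex)" .
  define b where "b = basis_completion v"
  define ws where "ws = gram_schmidt n b"
  have dist_b: "distinct b" and indep: "\<not> lin_dep (set b)" and b: "set b \<subseteq> carrier_vec n"
    and hdb: "hd b = v" and len_b: "length b = n"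
    unfolding b_def by (rule basis_completion[OF v])+
  have n: "0 < n" using v by (cases n) auto
  with hdb len_b obtain vs where bv: "b = v # vs" by (cases b) auto
  from gram_schmidt_result[OF b dist_b indep ws_def]
  have ws: "set ws \<subseteq> carrier_vec n" "corthogonal ws" "length ws = n" by (auto simp: len_b)
  have hdws: "hd ws = v" using gram_schmidt_hd[OF v(1), of vs] by (simp add: ws_def bv)
  define r where "r j = sqrt (Re (ws ! j \<bullet>c ws ! j))" for j
  define P where "P = mat n n (\<lambda>(i, j). ws ! j $ i / of_real (r j))"
  have P: "P \<in> carrier_mat n n" by (simp add: P_def)
  have ws_carrier: "ws ! j \<in> carrier_vec n" if "j < n" for j
    using ws that by (metis nth_mem subsetD)
  have self: "ws ! j \<bullet>c ws ! j = of_real ((r j)\<^sup>2)" "r j \<noteq> 0" if "j < n" for j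
  proof -
    have "ws ! j \<bullet>c ws ! j \<noteq> 0" using ws(2) that by (auto simp: corthogonal_def ws(3))
    moreover have "0 \<le> Re (ws ! j \<bullet>c ws ! j)" and "Im (ws ! j \<bullet>c ws ! j) = 0"
      unfolding cscalar_prod_self by (auto intro: sum_nonneg)
    ultimately show "ws ! j \<bullet>c ws ! j = of_real ((r j)\<^sup>2)" "r j \<noteq> 0"
      by (simp_all add: r_def complex_eq_iff)
  qed
  have "mat_adjoint P * P = 1\<^sub>m n"
  proof (rule eq_matI)
    fix i j assume "i < dim_row (1\<^sub>m n)" "j < dim_col (1\<^sub>m n)"
    then have ij: "i < n" "j < n" by auto
    have "(mat_adjoint P * P) $$ (i, j) =
      (\<Sum>k<n. cnj (ws ! i $ k / of_real (r i)) * (ws ! j $ k / of_real (r j)))"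
      using ij P by (simp add: scalar_prod_def atLeast0LessThan P_def)
    also have "\<dots> = (ws ! j \<bullet>c ws ! i) / of_real (r i * r j)"
      using ws_carrier[OF ij(1)] ws_carrier[OF ij(2)]
      by (simp add: scalar_prod_def atLeast0LessThan sum_divide_distrib mult_ac)
    also have "\<dots> = (if i = j then 1 else 0)"
    proof (cases "i = j")
      case True
      then show ?thesis using self[OF ij(2)] by (simp add: power2_eq_square)
    next
      case False
      then have "ws ! j \<bullet>c ws ! i = 0" using ws(2) ij by (auto simp: corthogonal_def ws(3))
      then show ?thesis using False by simp
    qed
    finally show "(mat_adjoint P * P) $$ (i, j) = 1\<^sub>m n $$ (i, j)" using ij by simp
  qed (use P in auto)
  moreover from this have "P * mat_adjoint P = 1\<^sub>m n"
    by (rule mat_mult_left_right_inverse[OF mat_adjoint_carrier[OF P] P])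
  ultimately have "unitary_mat P" using P by (auto simp: unitary_mat_def)
  have "ws ! 0 = v"
    using hdws hd_conv_nth[of ws] ws(3) n by force
  then have "col P 0 = (1 / of_real (r 0)) \<cdot>\<^sub>v v"
    using n v(1) by (intro eq_vecI) (auto simp: P_def)
  with P \<open>unitary_mat P\<close> show ?thesis by (rule that)
qed

lemma unitary_cscalar_prod:
  assumes P: "unitary_mat P" "P \<in> carrier_mat n n" and x: "x \<in> carrier_vec n"
  shows "(P *\<^sub>v x) \<bullet>c (P *\<^sub>v x) = x \<bullet>c x"
proof -
  have "(P *\<^sub>v x) \<bullet>c (P *\<^sub>v x) = x \<bullet>c ((mat_adjoint P * P) *\<^sub>v x)"
    using P x by (simp add: adjoint_scalar_prod[of P n n] assoc_mult_mat_vec[of _ n n _ n])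
  then show ?thesis using P x by (simp add: unitary_mat_def)
qed

text \<open>A contraction with a diagonal entry \<open>e\<close> of modulus one has no room for other entries in that
  row, so after completing an eigenvector to an orthonormal basis \<open>e\<close> splits off.\<close>

lemma unimodular_eigenvalue_imp_not_completely_nonunitary:
  fixes A :: "complex mat"
  assumes A: "A \<in> carrier_mat n n"
    and contraction: "\<And>x. x \<in> carrier_vec n \<Longrightarrow> Re ((A *\<^sub>v x) \<bullet>c (A *\<^sub>v x)) \<le> Re (x \<bullet>c x)"
    and ev: "eigenvalue A e" and e: "cmod e = 1"
  shows "\<not> completely_nonunitary A"
proof -
  obtain v where v: "v \<in> carrier_vec n" "v \<noteq> 0\<^sub>v n" "A *\<^sub>v v = e \<cdot>\<^sub>v v"
    using ev A unfolding eigenvalue_def eigenvector_def by auto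
  have n: "0 < n" using v by (cases n) auto
  obtain P c where P: "P \<in> carrier_mat n n" "unitary_mat P" and col: "col P 0 = c \<cdot>\<^sub>v v"
    using unitary_completion[OF v(1,2)] .
  have PP: "mat_adjoint P * P = 1\<^sub>m n" "P * mat_adjoint P = 1\<^sub>m n"
    using P by (auto simp: unitary_mat_def)
  have P': "mat_adjoint P \<in> carrier_mat n n" using P(1) by simp
  have P'_unitary: "unitary_mat (mat_adjoint P)"
  proof -
    have "mat_adjoint (mat_adjoint P) = P" by (rule eq_matI) auto
    then show ?thesis using P PP by (auto simp: unitary_mat_def)
  qed
  \<comment> \<open>In the new basis the first column is \<open>e\<close> times the first unit
    vector; contractivity will clear the first row.\<close>
  define T where "T = mat_adjoint P * A * P"
  have T: "T \<in> carrier_mat n n" unfolding T_def using P(1) P' A by (intro mult_carrier_mat)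
  have sim: "similar_mat_wit A T P (mat_adjoint P)"
  proof (rule similar_mat_witI[OF PP(2,1) _ A T P(1) P'])
    have "P * T * mat_adjoint P = (P * mat_adjoint P) * A * (P * mat_adjoint P)"
      unfolding T_def using P(1) P' A
      by (simp add: assoc_mult_mat[of _ n n _ n _ n] mult_carrier_mat[of _ n n _ n])
    then show "A = P * T * mat_adjoint P" using PP A by simp
  qed
  have T_vec: "T *\<^sub>v x = mat_adjoint P *\<^sub>v (A *\<^sub>v (P *\<^sub>v x))" if "x \<in> carrier_vec n" for x
    unfolding T_def using that P(1) P' A
    by (simp add: assoc_mult_mat_vec[of _ n n _ n] mult_carrier_mat[of _ n n _ n])
  have T_contraction: "Re ((T *\<^sub>v x) \<bullet>c (T *\<^sub>v x)) \<le> Re (x \<bullet>c x)" if "x \<in> carrier_vec n" for x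
    using contraction[of "P *\<^sub>v x"] that P A
    by (simp add: T_vec unitary_cscalar_prod[OF P'_unitary P'] unitary_cscalar_prod[OF P(2,1)])
  have T_col: "T $$ (i, 0) = (if i = 0 then e else 0)" if i: "i < n" for i
  proof -
    have "T = mat_adjoint P * (A * P)"
      unfolding T_def by (rule assoc_mult_mat[OF P' A P(1)])
    then have "col T 0 = mat_adjoint P *\<^sub>v (A *\<^sub>v col P 0)"
      by (simp only: col_mult2[OF P' mult_carrier_mat[OF A P(1)] n] col_mult2[OF A P(1) n])
    also have "A *\<^sub>v col P 0 = e \<cdot>\<^sub>v col P 0"
      unfolding col using v A by (simp add: mult_mat_vec smult_smult_assoc mult.commute)
    also have "mat_adjoint P *\<^sub>v (e \<cdot>\<^sub>v col P 0) = e \<cdot>\<^sub>v col (mat_adjoint P * P) 0"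
      using n P(1) P' by (simp add: mult_mat_vec[OF P'] col_mult2[of _ n n _ n])
    finally have "col T 0 = e \<cdot>\<^sub>v col (1\<^sub>m n) 0" by (simp add: PP)
    then have "col T 0 $ i = (e \<cdot>\<^sub>v col (1\<^sub>m n) 0) $ i" by simp
    then show ?thesis using i n T by auto
  qed
  \<comment> \<open>The squared norm of row 0. Applied to the conjugate of that row,
    \<open>T\<close> has \<open>s\<close> in coordinate 0, so contractivity gives
    \<open>s\<^sup>2 \<le> s\<close>. The corner entry of modulus 1 then uses up all of
    \<open>s\<close>.\<close>
  define s where "s = (\<Sum>j<n. (cmod (T $$ (0, j)))\<^sup>2)"
  have "s\<^sup>2 \<le> s"
  proof -
    define y where "y = vec n (\<lambda>j. cnj (T $$ (0, j)))"
    have y: "y \<in> carrier_vec n" by (simp add: y_def)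
    have Ty: "(T *\<^sub>v y) $ 0 = of_real s"
      using n T by (simp add: y_def s_def scalar_prod_def atLeast0LessThan complex_norm_square
          del: of_real_power)
    have "(cmod ((T *\<^sub>v y) $ 0))\<^sup>2 \<le> (\<Sum>i<n. (cmod ((T *\<^sub>v y) $ i))\<^sup>2)"
      using n by (intro member_le_sum) auto
    also have "\<dots> = Re ((T *\<^sub>v y) \<bullet>c (T *\<^sub>v y))"
      using T by (simp add: cscalar_prod_self)
    also have "\<dots> \<le> Re (y \<bullet>c y)" by (rule T_contraction[OF y])
    also have "\<dots> = s" by (simp add: cscalar_prod_self) (simp add: y_def s_def)
    finally show ?thesis by (simp add: Ty)
  qed
  then have "s * (s - 1) \<le> 0" by (simp add: power2_eq_square algebra_simps)
  then have "s \<le> 1" by (auto simp: mult_le_0_iff)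
  have "s = (cmod (T $$ (0, 0)))\<^sup>2 + (\<Sum>j\<in>{..<n} - {0}. (cmod (T $$ (0, j)))\<^sup>2)"
    unfolding s_def using n by (intro sum.remove) auto
  with \<open>s \<le> 1\<close> have "(\<Sum>j\<in>{..<n} - {0}. (cmod (T $$ (0, j)))\<^sup>2) \<le> 0"
    using T_col[OF n] e by simp
  then have "(\<Sum>j\<in>{..<n} - {0}. (cmod (T $$ (0, j)))\<^sup>2) = 0"
    by (intro antisym sum_nonneg) auto
  then have T_row: "T $$ (0, j) = 0" if "j < n" "0 < j" for j
    using that by (subst (asm) sum_nonneg_eq_0_iff) auto
  define U where "U = mat 1 1 (\<lambda>_. e)"
  define C where "C = mat (n - 1) (n - 1) (\<lambda>(i, j). T $$ (Suc i, Suc j))"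
  have "T = four_block_mat U (0\<^sub>m 1 (n - 1)) (0\<^sub>m (n - 1) 1) C"
    by (rule eq_matI) (use n T in \<open>auto simp: U_def C_def T_col T_row\<close>)
  also have "\<dots> = diag_block_mat [U, C]"
    by (rule diag_block_mat_pair(1)[symmetric]) (auto simp: U_def C_def)
  finally have "unitarily_similar A (diag_block_mat [U, C])"
    using sim P(2) unfolding unitarily_similar_def by blast
  moreover have "unitary_mat U"
  proof -
    have "cnj e * e = 1" using e by (metis complex_norm_square mult.commute of_real_1 power_one)
    then show ?thesis
      unfolding unitary_mat_def U_def
      by (auto intro!: eq_matI simp: scalar_prod_def mult.commute)
  qed
  moreover have "dim_row U \<ge> 1" "square_mat C" by (auto simp: U_def C_def)
  ultimately show ?thesis unfolding completely_nonunitary_def by blast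
qed

subsection \<open>Coordinate vectors and extremal values\<close>

definition fscale :: "complex \<Rightarrow> ('i \<Rightarrow> complex) \<Rightarrow> 'i \<Rightarrow> complex" where
  "fscale c x = (\<lambda>i. c * x i)"

text \<open>Vectors are total functions with pointwise addition, which fits the abstract locale;
  only the coordinates in \<open>I\<close> are seen.\<close>

definition cinner :: "'i set \<Rightarrow> ('i \<Rightarrow> complex) \<Rightarrow> ('i \<Rightarrow> complex) \<Rightarrow> complex" where
  "cinner I x y = (\<Sum>i\<in>I. x i * cnj (y i))"

lemma fscale_apply [simp]: "fscale c x i = c * x i"
  by (simp add: fscale_def)

lemma semi_inner_product_cinner: "semi_inner_product fscale (cinner I)"
proof
  show "0 \<le> Re (cinner I x x)" for x
    unfolding cinner_def Re_sum by (intro sum_nonneg) (simp add: complex_mult_cnj)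
qed (auto simp: cinner_def algebra_simps sum.distrib sum_distrib_left)

interpretation cinner: semi_inner_product fscale "cinner I" for I
  by (rule semi_inner_product_cinner)

lemma cinner_cong:
  "(\<And>i. i \<in> I \<Longrightarrow> x i = x' i) \<Longrightarrow> (\<And>i. i \<in> I \<Longrightarrow> y i = y' i) \<Longrightarrow> cinner I x y = cinner I x' y'"
  by (simp add: cinner_def)

lemma Re_cinner_self: "Re (cinner I x x) = (\<Sum>i\<in>I. (cmod (x i))\<^sup>2)"
  by (simp add: cinner_def complex_norm_square [symmetric] del: of_real_power)

lemma cinner_self_eq_iff: "cinner I x x = of_real r \<longleftrightarrow> Re (cinner I x x) = r"
  by (simp add: complex_eq_iff)

definition mat_apply :: "nat \<Rightarrow> (nat \<Rightarrow> nat \<Rightarrow> complex) \<Rightarrow> (nat \<Rightarrow> complex) \<Rightarrow> nat \<Rightarrow> complex" where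
  "mat_apply n a x i = (\<Sum>l<n. a i l * x l)"

abbreviation entries :: "complex mat \<Rightarrow> nat \<Rightarrow> nat \<Rightarrow> complex" where
  "entries M \<equiv> \<lambda>i j. M $$ (i, j)"

definition adjoint_entries :: "(nat \<Rightarrow> nat \<Rightarrow> complex) \<Rightarrow> nat \<Rightarrow> nat \<Rightarrow> complex" where
  "adjoint_entries a i j = cnj (a j i)"

lemma mat_apply_cong: "(\<And>l. l < n \<Longrightarrow> x l = y l) \<Longrightarrow> mat_apply n a x = mat_apply n a y"
  by (simp add: mat_apply_def fun_eq_iff)

lemma mat_apply_add: "mat_apply n a (x + y) = mat_apply n a x + mat_apply n a y"
  by (simp add: mat_apply_def fun_eq_iff distrib_left sum.distrib)

lemma mat_apply_fscale: "mat_apply n a (fscale c x) = fscale c (mat_apply n a x)"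
  by (simp add: mat_apply_def fun_eq_iff sum_distrib_left mult_ac)

lemma cinner_mat_apply: "cinner {..<n} (mat_apply n a x) y = cinner {..<n} x (mat_apply n (adjoint_entries a) y)"
proof -
  have "cinner {..<n} (mat_apply n a x) y = (\<Sum>i<n. \<Sum>l<n. a i l * x l * cnj (y i))"
    by (simp add: cinner_def mat_apply_def sum_distrib_right)
  also have "\<dots> = (\<Sum>l<n. \<Sum>i<n. a i l * x l * cnj (y i))"
    by (rule sum.swap)
  also have "\<dots> = cinner {..<n} x (mat_apply n (adjoint_entries a) y)"
    by (simp add: cinner_def mat_apply_def adjoint_entries_def sum_distrib_left mult_ac)
  finally show ?thesis .
qed

lemma continuous_on_mat_apply [continuous_intros]: "continuous_on S (\<lambda>x. mat_apply n a x i)"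
  unfolding mat_apply_def
  by (intro continuous_intros continuous_on_subset[OF continuous_on_product_coordinates]) auto

lemma continuous_on_cinner [continuous_intros]:
  assumes "\<And>i. i \<in> I \<Longrightarrow> continuous_on S (\<lambda>x. f x i)" "\<And>i. i \<in> I \<Longrightarrow> continuous_on S (\<lambda>x. g x i)"
  shows "continuous_on S (\<lambda>x. cinner I (f x) (g x))"
  unfolding cinner_def by (intro continuous_intros assms)

text \<open>The sphere itself is not compact here, as the coordinates from \<open>n\<close> on are
  free. Fixing them at 0 gives a closed subset of a product of compact sets, compact by Tychonoff's
  theorem, and by \<open>local\<close> this does not affect \<open>f\<close>.\<close>

lemma unit_sphere_attains_max:
  fixes f :: "(nat \<Rightarrow> complex) \<Rightarrow> real"
  assumes n: "0 < n" and cont: "continuous_on UNIV f"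
    and local: "\<And>x y. (\<And>i. i < n \<Longrightarrow> x i = y i) \<Longrightarrow> f x = f y"
  obtains x where "cinner {..<n} x x = 1" "\<And>y. cinner {..<n} y y = 1 \<Longrightarrow> f y \<le> f x"
proof -
  \<comment> \<open>A compact square containing the unit disc, where all coordinates of unit vectors
    lie.\<close>
  define Q where "Q = (\<lambda>(a, b). of_real a + \<i> * of_real b) ` ({- 1..1} \<times> {- 1..1 :: real})"
  have "compact Q"
    unfolding Q_def case_prod_beta
    by (intro compact_continuous_image continuous_intros compact_Times compact_Icc)
  have Q: "z \<in> Q" if "cmod z \<le> 1" for z
  proof -
    have "\<bar>Re z\<bar> \<le> 1" "\<bar>Im z\<bar> \<le> 1"
      using that abs_Re_le_cmod[of z] abs_Im_le_cmod[of z] by linarith+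
    moreover have "z = of_real (Re z) + \<i> * of_real (Im z)" by (rule complex_eq)
    ultimately show ?thesis unfolding Q_def by (intro image_eqI[of _ _ "(Re z, Im z)"]) auto
  qed
  define D where "D i = (if i < n then Q else {0})" for i
  define S where "S = Pi\<^sub>E UNIV D \<inter> {x. cinner {..<n} x x = 1}"
  have "compactin (product_topology (\<lambda>_. euclidean) UNIV) (Pi\<^sub>E UNIV D)"
    by (subst compactin_PiE) (simp add: D_def \<open>compact Q\<close>)
  then have "compact (Pi\<^sub>E UNIV D)"
    by (simp add: euclidean_product_topology)
  moreover have "closed {x :: nat \<Rightarrow> complex. cinner {..<n} x x = 1}"
    by (intro closed_Collect_eq continuous_intros continuous_on_product_coordinates)
  ultimately have "compact S" unfolding S_def by (rule compact_Int_closed)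
  moreover have "(\<lambda>i. if i = 0 then 1 else 0) \<in> S"
  proof -
    have "cinner {..<n} (\<lambda>i. if i = 0 then 1 else 0) (\<lambda>i. if i = 0 then 1 else 0) =
      (\<Sum>i<n. if i = 0 then 1 else 0)"
      unfolding cinner_def by (rule sum.cong) auto
    then show ?thesis using n Q[of 0] Q[of 1] by (auto simp: S_def D_def)
  qed
  moreover have "continuous_on S f" using cont by (rule continuous_on_subset) simp
  ultimately obtain x where x: "x \<in> S" and max: "\<And>y. y \<in> S \<Longrightarrow> f y \<le> f x"
    using continuous_attains_sup[of S f] by auto
  have "f y \<le> f x" if y: "cinner {..<n} y y = 1" for y
  proof -
    define y' where "y' i = (if i < n then y i else 0)" for i
    have "cinner {..<n} y' y' = cinner {..<n} y y" by (rule cinner_cong) (auto simp: y'_def)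
    moreover have "cmod (y i) \<le> 1" if "i < n" for i
    proof -
      have "(cmod (y i))\<^sup>2 \<le> (\<Sum>i<n. (cmod (y i))\<^sup>2)"
        using that by (intro member_le_sum) auto
      also have "\<dots> = 1" using y by (simp add: Re_cinner_self [symmetric])
      finally show ?thesis by (simp add: abs_square_le_1)
    qed
    ultimately have "y' \<in> S" using y Q by (auto simp: S_def D_def y'_def)
    then have "f y' \<le> f x" by (rule max)
    then show ?thesis using local[of y' y] by (simp add: y'_def)
  qed
  with x that show ?thesis by (auto simp: S_def)
qed

text \<open>Scale \<open>y\<close> to norm one. In the null case \<open>y\<close> is known to vanish
  only below \<open>n\<close>, so \<open>local\<close> is used to compare \<open>f y\<close> with
  \<open>f (fscale 0 y)\<close>.\<close>

lemma unit_bound_imp_quadratic_bound: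
  fixes f :: "(nat \<Rightarrow> complex) \<Rightarrow> real"
  assumes hom: "\<And>c y. f (fscale c y) = (cmod c)\<^sup>2 * f y"
    and local: "\<And>x y. (\<And>i. i < n \<Longrightarrow> x i = y i) \<Longrightarrow> f x = f y"
    and bound: "\<And>y. cinner {..<n} y y = 1 \<Longrightarrow> f y \<le> w"
  shows "f y \<le> w * Re (cinner {..<n} y y)"
proof (cases "Re (cinner {..<n} y y) = 0")
  case True
  then have "\<forall>i<n. y i = 0" by (simp add: Re_cinner_self sum_nonneg_eq_0_iff)
  then have "f y = f (fscale 0 y)" by (intro local) simp
  then show ?thesis using True by (simp add: hom)
next
  case False
  define r where "r = sqrt (Re (cinner {..<n} y y))"
  have pos: "0 < Re (cinner {..<n} y y)" using False cinner.ip_self_nonneg[of "{..<n}" y] by simp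
  then have r: "0 < r" "r\<^sup>2 = Re (cinner {..<n} y y)" by (simp_all add: r_def)
  have "cinner {..<n} y y = of_real (r\<^sup>2)" unfolding cinner_self_eq_iff r(2) ..
  then have "cinner {..<n} (fscale (of_real (1 / r)) y) (fscale (of_real (1 / r)) y) = 1"
    using r(1) by (simp add: cinner.ip_scale cinner.ip_scale_right power2_eq_square)
  from bound[OF this] have "(1 / r)\<^sup>2 * f y \<le> w"
    using r(1) by (simp add: hom norm_divide)
  then have "f y \<le> w * r\<^sup>2" using r(1) by (simp add: power_divide divide_le_eq)
  then show ?thesis unfolding r(2) .
qed

lemma vec_index_mult_mat_vec:
  assumes "M \<in> carrier_mat n k" "x \<in> carrier_vec k" "i < n"
  shows "(M *\<^sub>v x) $ i = mat_apply k (entries M) (vec_index x) i"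
  using assms by (simp add: mat_apply_def scalar_prod_def atLeast0LessThan)

lemma cscalar_prod_eq_cinner:
  assumes "x \<in> carrier_vec n" "y \<in> carrier_vec n"
  shows "x \<bullet>c y = cinner {..<n} (vec_index x) (vec_index y)"
  using assms by (simp add: cinner_def scalar_prod_def atLeast0LessThan)

lemma cscalar_prod_mult_mat_vec:
  assumes "M \<in> carrier_mat n n" "x \<in> carrier_vec n"
  shows "(M *\<^sub>v x) \<bullet>c x = cinner {..<n} (mat_apply n (entries M) (vec_index x)) (vec_index x)"
    and "(M *\<^sub>v x) \<bullet>c (M *\<^sub>v x) = cinner {..<n} (mat_apply n (entries M) (vec_index x)) (mat_apply n (entries M) (vec_index x))"
  using assms
  by (auto simp: cscalar_prod_eq_cinner[of _ n] vec_index_mult_mat_vec[of M n n]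
      simp del: index_mult_mat_vec intro!: cinner_cong)

lemma unit_sphere_iff:
  "x \<in> unit_sphere n \<longleftrightarrow> x \<in> carrier_vec n \<and> cinner {..<n} (vec_index x) (vec_index x) = 1"
  using cinner_self_eq_iff[of "{..<n}" "vec_index x" 1]
  by (auto simp: unit_sphere_def euclidean_norm_def cscalar_prod_eq_cinner[of _ n])

lemma vec_in_unit_sphere:
  "cinner {..<n} x x = 1 \<Longrightarrow> vec n x \<in> unit_sphere n"
  using cinner_cong[of "{..<n}" "vec_index (vec n x)" x "vec_index (vec n x)" x]
  by (simp add: unit_sphere_iff)

lemma numerical_range_eq:
  assumes M: "M \<in> carrier_mat n n"
  shows "numerical_range M =
    {cinner {..<n} (mat_apply n (entries M) x) x | x. cinner {..<n} x x = 1}" (is "_ = ?R")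
proof
  show "numerical_range M \<subseteq> ?R"
    using M by (auto simp: numerical_range_def unit_sphere_iff cscalar_prod_mult_mat_vec)
  have "cinner {..<n} (mat_apply n (entries M) x) x \<in> numerical_range M" if x: "cinner {..<n} x x = 1" for x
  proof -
    have "cinner {..<n} (mat_apply n (entries M) x) x =
      cinner {..<n} (mat_apply n (entries M) (vec_index (vec n x))) (vec_index (vec n x))"
      using mat_apply_cong[of n x "vec_index (vec n x)"] by (intro cinner_cong) auto
    also have "\<dots> = (M *\<^sub>v vec n x) \<bullet>c vec n x"
      using M by (simp add: cscalar_prod_mult_mat_vec)
    finally show ?thesis
      using M vec_in_unit_sphere[OF x] by (auto simp: numerical_range_def)
  qed
  then show "?R \<subseteq> numerical_range M" by blast
qed

lemma numerical_radius_attained: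
  assumes M: "M \<in> carrier_mat n n" and n: "0 < n"
  obtains x where "cinner {..<n} x x = 1"
    "cmod (cinner {..<n} (mat_apply n (entries M) x) x) = numerical_radius M"
    "\<And>y. cmod (cinner {..<n} (mat_apply n (entries M) y) y) \<le> numerical_radius M * Re (cinner {..<n} y y)"
proof -
  define f where "f x = cmod (cinner {..<n} (mat_apply n (entries M) x) x)" for x
  have local: "f x = f y" if "\<And>i. i < n \<Longrightarrow> x i = y i" for x y
    unfolding f_def using mat_apply_cong[of n x y] that by (auto intro!: arg_cong[where f = cmod] cinner_cong)
  have "continuous_on UNIV f"
    unfolding f_def by (intro continuous_intros continuous_on_product_coordinates)
  then obtain x where x: "cinner {..<n} x x = 1" and max: "\<And>y. cinner {..<n} y y = 1 \<Longrightarrow> f y \<le> f x"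
    using unit_sphere_attains_max[OF n, of f] local by metis
  have "numerical_radius M = f x"
    unfolding numerical_radius_def numerical_range_eq[OF M]
    by (rule cSup_eq_maximum) (use x max in \<open>auto simp: f_def\<close>)
  moreover have "f y \<le> f x * Re (cinner {..<n} y y)" for y
  proof (rule unit_bound_imp_quadratic_bound[where f = f])
    show "f (fscale c y) = (cmod c)\<^sup>2 * f y" for c y
      by (simp add: f_def mat_apply_fscale cinner.ip_scale cinner.ip_scale_right norm_mult power2_eq_square)
    show "f x = f y" if "\<And>i. i < n \<Longrightarrow> x i = y i" for x y using that by (rule local)
    show "f y \<le> f x" if "cinner {..<n} y y = 1" for y using that by (rule max)
  qed
  ultimately show ?thesis using x that by (simp add: f_def)
qed

text \<open>Compactness shows that the norms on the sphere are bounded above, so \<open>SUP\<close>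
  is a genuine upper bound; homogeneity does the rest.\<close>

lemma operator_norm_bound:
  assumes M: "M \<in> carrier_mat n n" and n: "0 < n"
  shows "Re (cinner {..<n} (mat_apply n (entries M) y) (mat_apply n (entries M) y)) \<le>
    (operator_norm M)\<^sup>2 * Re (cinner {..<n} y y)"
proof -
  define f where "f x = Re (cinner {..<n} (mat_apply n (entries M) x) (mat_apply n (entries M) x))" for x
  have local: "f x = f y" if "\<And>i. i < n \<Longrightarrow> x i = y i" for x y
    unfolding f_def using mat_apply_cong[of n x y] that by simp
  have f_vec: "euclidean_norm (M *\<^sub>v v) = sqrt (f (vec_index v))" if "v \<in> carrier_vec n" for v
    using M that by (simp add: euclidean_norm_def f_def cscalar_prod_mult_mat_vec)
  have "continuous_on UNIV f"
    unfolding f_def by (intro continuous_intros)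
  then obtain x where max: "\<And>y. cinner {..<n} y y = 1 \<Longrightarrow> f y \<le> f x"
    using unit_sphere_attains_max[OF n, of f] local by metis
  have "f y \<le> (operator_norm M)\<^sup>2" if y: "cinner {..<n} y y = 1" for y
  proof -
    have "sqrt (f y) = sqrt (f (vec_index (vec n y)))"
      by (intro arg_cong[where f = sqrt] local) simp
    also have "\<dots> = euclidean_norm (M *\<^sub>v vec n y)" by (simp add: f_vec)
    also have "\<dots> \<le> operator_norm M"
      unfolding operator_norm_def
    proof (rule cSUP_upper)
      show "vec n y \<in> unit_sphere (dim_col M)" using M vec_in_unit_sphere[OF y] by simp
      show "bdd_above ((\<lambda>x. euclidean_norm (M *\<^sub>v x)) ` unit_sphere (dim_col M))"
        using M max by (intro bdd_aboveI[of _ "sqrt (f x)"]) (auto simp: unit_sphere_iff f_vec)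
    qed
    finally have "sqrt (f y) \<le> operator_norm M" .
    then show ?thesis by (rule sqrt_le_D)
  qed
  then have "f y \<le> (operator_norm M)\<^sup>2 * Re (cinner {..<n} y y)"
  proof (rule unit_bound_imp_quadratic_bound[where f = f, rotated 2])
    show "f (fscale c y) = (cmod c)\<^sup>2 * f y" for c y
      by (simp add: f_def mat_apply_fscale cinner.ip_scale cinner.ip_scale_right cmod_power2)
        (simp add: power2_eq_square algebra_simps)
    show "f x = f y" if "\<And>i. i < n \<Longrightarrow> x i = y i" for x y using that by (rule local)
  qed
  then show ?thesis by (simp add: f_def)
qed

subsection \<open>Kronecker products\<close>

text \<open>This is \<open>A \<otimes> I\<close> on vectors indexed by pairs, and
  \<open>apply_snd\<close> is \<open>I \<otimes> B\<close>. Pairs keep \<open>div\<close> and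
  \<open>mod\<close> out of the operator arguments.\<close>

definition apply_fst :: "nat \<Rightarrow> (nat \<Rightarrow> nat \<Rightarrow> complex) \<Rightarrow> (nat \<times> nat \<Rightarrow> complex) \<Rightarrow> nat \<times> nat \<Rightarrow> complex" where
  "apply_fst n a x = (\<lambda>(i, j). mat_apply n a (\<lambda>k. x (k, j)) i)"

definition apply_snd :: "nat \<Rightarrow> (nat \<Rightarrow> nat \<Rightarrow> complex) \<Rightarrow> (nat \<times> nat \<Rightarrow> complex) \<Rightarrow> nat \<times> nat \<Rightarrow> complex" where
  "apply_snd m b x = (\<lambda>(i, j). mat_apply m b (\<lambda>l. x (i, l)) j)"

abbreviation grid :: "nat \<Rightarrow> nat \<Rightarrow> (nat \<times> nat) set" where
  "grid n m \<equiv> {..<n} \<times> {..<m}"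

lemma apply_fst_add: "apply_fst n a (x + y) = apply_fst n a x + apply_fst n a y"
  by (simp add: apply_fst_def mat_apply_def fun_eq_iff distrib_left sum.distrib)

lemma apply_snd_add: "apply_snd m b (x + y) = apply_snd m b x + apply_snd m b y"
  by (simp add: apply_snd_def mat_apply_def fun_eq_iff distrib_left sum.distrib)

lemma apply_fst_fscale: "apply_fst n a (fscale c x) = fscale c (apply_fst n a x)"
  by (simp add: apply_fst_def mat_apply_def fun_eq_iff sum_distrib_left mult_ac)

lemma apply_snd_fscale: "apply_snd m b (fscale c x) = fscale c (apply_snd m b x)"
  by (simp add: apply_snd_def mat_apply_def fun_eq_iff sum_distrib_left mult_ac)

lemma apply_fst_apply_snd: "apply_fst n a (apply_snd m b x) = apply_snd m b (apply_fst n a x)"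
proof
  fix p :: "nat \<times> nat"
  obtain i j where p: "p = (i, j)" by (cases p)
  have "apply_fst n a (apply_snd m b x) p = (\<Sum>k<n. \<Sum>l<m. a i k * (b j l * x (k, l)))"
    by (simp add: p apply_fst_def apply_snd_def mat_apply_def sum_distrib_left)
  also have "\<dots> = (\<Sum>l<m. \<Sum>k<n. a i k * (b j l * x (k, l)))" by (rule sum.swap)
  also have "\<dots> = apply_snd m b (apply_fst n a x) p"
    by (simp add: p apply_fst_def apply_snd_def mat_apply_def sum_distrib_left mult_ac)
  finally show "apply_fst n a (apply_snd m b x) p = apply_snd m b (apply_fst n a x) p" .
qed

lemma cinner_grid_rows:
  "cinner (grid n m) x y = (\<Sum>i<n. cinner {..<m} (\<lambda>j. x (i, j)) (\<lambda>j. y (i, j)))"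
  by (simp add: cinner_def sum.cartesian_product)

lemma cinner_grid_cols:
  "cinner (grid n m) x y = (\<Sum>j<m. cinner {..<n} (\<lambda>i. x (i, j)) (\<lambda>i. y (i, j)))"
  unfolding cinner_grid_rows unfolding cinner_def by (rule sum.swap)

lemma apply_fst_col: "(\<lambda>i. apply_fst n a x (i, j)) = mat_apply n a (\<lambda>i. x (i, j))"
  by (simp add: apply_fst_def fun_eq_iff)

lemma apply_snd_row: "(\<lambda>j. apply_snd m b x (i, j)) = mat_apply m b (\<lambda>j. x (i, j))"
  by (simp add: apply_snd_def fun_eq_iff)

lemma cinner_apply_fst: "cinner (grid n m) (apply_fst n a x) y = cinner (grid n m) x (apply_fst n (adjoint_entries a) y)"
  unfolding cinner_grid_cols apply_fst_col by (simp add: cinner_mat_apply)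

lemma cinner_apply_snd: "cinner (grid n m) (apply_snd m b x) y = cinner (grid n m) x (apply_snd m (adjoint_entries b) y)"
  unfolding cinner_grid_rows apply_snd_row by (simp add: cinner_mat_apply)

lemma adjoint_adjoint_entries [simp]: "adjoint_entries (adjoint_entries a) = a"
  by (simp add: adjoint_entries_def fun_eq_iff)

text \<open>\<open>A \<otimes> I\<close> acts on each column of the grid and
  \<open>I \<otimes> B\<close> on each row, so the bounds for the factors can be summed over columns
  or rows.\<close>

lemma commuting_contraction_grid:
  assumes a: "\<And>x. Re (cinner {..<n} (mat_apply n a x) (mat_apply n a x)) \<le> Re (cinner {..<n} x x)"
    and b: "\<And>x. cmod (cinner {..<m} (mat_apply m b x) x) \<le> w * Re (cinner {..<m} x x)" and w: "0 \<le> w"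
  shows "commuting_contraction fscale (cinner (grid n m)) (apply_fst n a)
    (apply_fst n (adjoint_entries a)) (apply_snd m b) w"
proof unfold_locales
  show "Re (cinner (grid n m) (apply_fst n a x) (apply_fst n a x)) \<le> Re (cinner (grid n m) x x)" for x
    unfolding cinner_grid_cols apply_fst_col Re_sum by (intro sum_mono a)
  show "cmod (cinner (grid n m) (apply_snd m b x) x) \<le> w * Re (cinner (grid n m) x x)" for x
    unfolding cinner_grid_rows apply_snd_row Re_sum sum_distrib_left
    by (rule order_trans[OF norm_sum]) (intro sum_mono b)
qed (simp_all add: apply_fst_add apply_snd_add apply_fst_fscale apply_snd_fscale cinner_apply_fst
    apply_fst_apply_snd w)

lemma index_lt_grid: "i < n \<Longrightarrow> j < m \<Longrightarrow> i * m + j < n * (m :: nat)"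
proof -
  assume ij: "i < n" "j < m"
  have "i * m + j < Suc i * m" using ij by simp
  also have "\<dots> \<le> n * m" using ij by (intro mult_le_mono1) simp
  finally show ?thesis .
qed

lemma sum_grid:
  fixes f :: "nat \<Rightarrow> 'a :: comm_monoid_add"
  shows "(\<Sum>p<n * m. f p) = (\<Sum>(i, j)\<in>grid n m. f (i * m + j))"
proof (rule sum.reindex_bij_witness[of _ "\<lambda>(i, j). i * m + j" "\<lambda>p. (p div m, p mod m)"])
  fix p assume "p \<in> {..<n * m}"
  then have p: "p < n * m" by simp
  then have "0 < m" by (cases m) auto
  with p show "(p div m, p mod m) \<in> grid n m" by (simp add: less_mult_imp_div_less)
next
  fix q assume "q \<in> grid n m"
  then obtain i j where q: "q = (i, j)" "i < n" "j < m" by auto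
  then show "(case q of (i, j) \<Rightarrow> i * m + j) \<in> {..<n * m}" by (simp add: index_lt_grid)
qed auto

lemma kronecker_product_carrier [simp]:
  "A \<in> carrier_mat n n \<Longrightarrow> B \<in> carrier_mat m m \<Longrightarrow> kronecker_product A B \<in> carrier_mat (n * m) (n * m)"
  by (auto simp: kronecker_product_def)

text \<open>Indexing by \<open>i * m + j\<close> undoes the \<open>div\<close> and
  \<open>mod\<close> in \<open>kronecker_product\<close>, which becomes the composite of the two
  commuting operators.\<close>

lemma cinner_kronecker_product:
  assumes A: "A \<in> carrier_mat n n" and B: "B \<in> carrier_mat m m"
  defines "X \<equiv> \<lambda>x (i, j). x (i * m + j)"
  shows "cinner {..<n * m} (mat_apply (n * m) (entries (kronecker_product A B)) x) x =
    cinner (grid n m) (apply_fst n (entries A) (apply_snd m (entries B) (X x))) (X x)"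
    and "cinner {..<n * m} x x = cinner (grid n m) (X x) (X x)"
proof -
  have entry: "mat_apply (n * m) (entries (kronecker_product A B)) x (i * m + j) =
    apply_fst n (entries A) (apply_snd m (entries B) (X x)) (i, j)" if ij: "i < n" "j < m" for i j
  proof -
    have "mat_apply (n * m) (entries (kronecker_product A B)) x (i * m + j) =
      (\<Sum>(k, l)\<in>grid n m. A $$ (i, k) * B $$ (j, l) * x (k * m + l))"
      unfolding mat_apply_def sum_grid
      using A B ij by (intro sum.cong refl) (auto simp: kronecker_product_def index_lt_grid)
    also have "\<dots> = apply_fst n (entries A) (apply_snd m (entries B) (X x)) (i, j)"
      by (simp add: apply_fst_def apply_snd_def mat_apply_def X_def sum_distrib_left sum.cartesian_product mult_ac)
    finally show ?thesis .
  qed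
  show "cinner {..<n * m} (mat_apply (n * m) (entries (kronecker_product A B)) x) x =
    cinner (grid n m) (apply_fst n (entries A) (apply_snd m (entries B) (X x))) (X x)"
    unfolding cinner_def sum_grid by (intro sum.cong refl) (auto simp: entry X_def)
  show "cinner {..<n * m} x x = cinner (grid n m) (X x) (X x)"
    unfolding cinner_def sum_grid by (intro sum.cong refl) (auto simp: X_def)
qed

section \<open>Singular quadratic pencils\<close>

text \<open>Formal power series form a domain, so a nonzero solution over them kills the determinant of the
  polynomial system.\<close>

lemma singular_of_fps_solution:
  fixes P :: "complex poly mat" and v :: "complex fps vec"
  assumes P: "P \<in> carrier_mat m m" and v: "v \<in> carrier_vec m" "v \<noteq> 0\<^sub>v m"
    and zero: "map_mat fps_of_poly P *\<^sub>v v = 0\<^sub>v m"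
  obtains y where "y \<in> carrier_vec m" "y \<noteq> 0\<^sub>v m" "map_mat (\<lambda>p. poly p z) P *\<^sub>v y = 0\<^sub>v m"
proof -
  interpret F: comm_ring_hom "fps_of_poly :: complex poly \<Rightarrow> complex fps"
    by unfold_locales (simp_all add: fps_of_poly_add fps_of_poly_mult)
  have poly_hom: "comm_ring_hom (\<lambda>p :: complex poly. poly p z)"
    by unfold_locales simp_all
  \<comment> \<open>Determinants commute with ring homomorphisms: here with the embedding into power
    series and then with evaluation at \<open>z\<close>.\<close>
  have "det (map_mat fps_of_poly P) = 0"
    using det_0_iff_vec_prod_zero[of "map_mat fps_of_poly P" m] P v zero by auto
  then have "fps_of_poly (det P) = fps_of_poly 0" by simp
  then have "det P = 0" unfolding fps_of_poly_eq_iff .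
  then have "det (map_mat (\<lambda>p. poly p z) P) = 0" by (simp add: comm_ring_hom.hom_det[OF poly_hom])
  then show ?thesis
    using det_0_iff_vec_prod_zero[of "map_mat (\<lambda>p. poly p z) P" m] P that by auto
qed

text \<open>The generating function of \<open>r\<close> solves the pencil equation formally. For
  \<open>k = 0\<close> the index \<open>k - 1\<close> truncates to 0, where \<open>r\<close>
  vanishes, so the recurrence then says that \<open>b\<close> annihilates
  \<open>r 1\<close>.\<close>

lemma singular_pencil_of_recurrence:
  fixes b :: "nat \<Rightarrow> nat \<Rightarrow> complex" and r :: "nat \<Rightarrow> nat \<Rightarrow> complex" and c z :: complex
  assumes r0: "\<And>j. j < m \<Longrightarrow> r 0 j = 0" and nonzero: "j0 < m" "r k0 j0 \<noteq> 0"
    and rec: "\<And>k j. j < m \<Longrightarrow> c * r k j = mat_apply m b (r (Suc k)) j + mat_apply m (adjoint_entries b) (r (k - 1)) j"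
  obtains y j where "j < m" "y j \<noteq> 0"
    "\<And>j. j < m \<Longrightarrow> mat_apply m b y j - c * z * y j + z\<^sup>2 * mat_apply m (adjoint_entries b) y j = 0"
proof -
  define P where "P = mat m m (\<lambda>(j, l). [: b j l, if j = l then - c else 0, adjoint_entries b j l :])"
  define v where "v = vec m (\<lambda>l. Abs_fps (\<lambda>k. r k l))"
  have P: "P \<in> carrier_mat m m" and v: "v \<in> carrier_vec m" by (simp_all add: P_def v_def)
  have "v $ j0 \<noteq> 0" using nonzero by (auto simp: v_def fps_eq_iff)
  then have v0: "v \<noteq> 0\<^sub>v m" using nonzero by auto
  have mat_apply_zero: "mat_apply m a x j = 0" if "\<And>l. l < m \<Longrightarrow> x l = 0" for a x j
    using that by (simp add: mat_apply_def)
  have "map_mat fps_of_poly P *\<^sub>v v = 0\<^sub>v m"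
  proof (rule eq_vecI)
    fix j assume "j < dim_vec (0\<^sub>v m :: complex fps vec)"
    then have j: "j < m" by simp
    have "fps_nth ((map_mat fps_of_poly P *\<^sub>v v) $ j) k = 0" for k
    proof -
      have entry: "fps_nth (fps_of_poly [: p, q, s :] * h) k = p * fps_nth h k
        + (if k = 0 then 0 else q * fps_nth h (k - 1)) + (if k < 2 then 0 else s * fps_nth h (k - 2))"
        for p q s :: complex and h
      proof -
        have "fps_of_poly [: p, q, s :] * h =
          fps_const p * h + fps_X * (fps_const q * h) + fps_X * (fps_X * (fps_const s * h))"
          by (simp add: fps_of_poly_pCons algebra_simps)
        then show ?thesis by (auto simp: fps_X_mult_nth numeral_2_eq_2)
      qed
      have "fps_nth ((map_mat fps_of_poly P *\<^sub>v v) $ j) k =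
        (\<Sum>l<m. fps_nth (fps_of_poly [: b j l, if j = l then - c else 0, adjoint_entries b j l :] *
          Abs_fps (\<lambda>k. r k l)) k)"
        using j by (simp add: P_def v_def scalar_prod_def atLeast0LessThan fps_sum_nth
            del: fps_of_poly_pCons)
      also have "\<dots> = mat_apply m b (r k) j + (if k = 0 then 0 else - c * r (k - 1) j)
        + (if k < 2 then 0 else mat_apply m (adjoint_entries b) (r (k - 2)) j)"
        unfolding entry using j
        by (auto simp: mat_apply_def sum.distrib if_distrib[of "\<lambda>x. x * _"] cong: if_cong)
      also have "\<dots> = 0"
      \<comment> \<open>The constant coefficient involves only \<open>r 0\<close>; coefficient
        \<open>Suc k'\<close> is the recurrence at \<open>k'\<close>.\<close>
      proof (cases k)
        case 0
        then show ?thesis using mat_apply_zero r0 by simp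
      next
        case (Suc k')
        then show ?thesis using rec[OF j, of k'] mat_apply_zero[of "r 0"] r0
          by (cases k') (auto simp: algebra_simps)
      qed
      finally show ?thesis .
    qed
    then show "(map_mat fps_of_poly P *\<^sub>v v) $ j = 0\<^sub>v m $ j" using j by (simp add: fps_eq_iff)
  qed (use P in simp)
  then obtain y where y: "y \<in> carrier_vec m" "y \<noteq> 0\<^sub>v m"
    and zero: "map_mat (\<lambda>p. poly p z) P *\<^sub>v y = 0\<^sub>v m"
    using singular_of_fps_solution[OF P v v0] by blast
  obtain j where j: "j < m" "y $ j \<noteq> 0" using y by (metis carrier_vecD eq_vecI index_zero_vec)
  have "mat_apply m b (vec_index y) i - c * z * y $ i + z\<^sup>2 * mat_apply m (adjoint_entries b) (vec_index y) i = 0"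
    if i: "i < m" for i
  proof -
    have "0 = (map_mat (\<lambda>p. poly p z) P *\<^sub>v y) $ i" using zero i by simp
    also have "\<dots> = (\<Sum>l<m. (b i l + z * ((if i = l then - c else 0) + z * adjoint_entries b i l)) * y $ l)"
      using i y(1) by (auto simp: P_def scalar_prod_def atLeast0LessThan intro!: sum.cong)
    also have "\<dots> = (\<Sum>l<m. b i l * y $ l + (if i = l then - (c * z * y $ l) else 0) +
        z\<^sup>2 * (adjoint_entries b i l * y $ l))"
      by (rule sum.cong) (auto simp: algebra_simps power2_eq_square)
    also have "\<dots> = mat_apply m b (vec_index y) i - c * z * y $ i + z\<^sup>2 * mat_apply m (adjoint_entries b) (vec_index y) i"
      using i by (simp add: mat_apply_def sum.distrib sum_distrib_left)
    finally show ?thesis by simp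
  qed
  with j show ?thesis by (rule that)
qed

subsection \<open>The circle in the numerical range\<close>

text \<open>An eigenvalue of maximal modulus has modulus at most 1 by contractivity, and modulus 1
  would split off a unitary summand.\<close>

lemma spectral_radius_less_1:
  assumes A: "A \<in> carrier_mat n n" and n: "0 < n"
    and contraction: "\<And>x. Re (cinner {..<n} (mat_apply n (entries A) x) (mat_apply n (entries A) x)) \<le> Re (cinner {..<n} x x)"
    and cnu: "completely_nonunitary A"
  shows "spectral_radius A < 1"
proof -
  have contraction_vec: "Re ((A *\<^sub>v x) \<bullet>c (A *\<^sub>v x)) \<le> Re (x \<bullet>c x)" if "x \<in> carrier_vec n" for x
    using contraction[of "vec_index x"] cscalar_prod_mult_mat_vec(2)[OF A that]
    by (simp add: cscalar_prod_eq_cinner[OF that that])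
  obtain e where e: "eigenvalue A e" "spectral_radius A = cmod e"
    using spectral_radius_mem_max(1)[OF A n] by (auto simp: spectrum_def)
  then obtain v where v: "v \<in> carrier_vec n" "v \<noteq> 0\<^sub>v n" "A *\<^sub>v v = e \<cdot>\<^sub>v v"
    using A unfolding eigenvalue_def eigenvector_def by auto
  have "v \<bullet>c v \<noteq> 0" using v(1,2) conjugate_square_eq_0_vec[of v n] by simp
  then have pos: "0 < Re (v \<bullet>c v)"
    using cinner.ip_self_nonneg[of "{..<n}" "vec_index v"] cinner.Im_ip_self[of "{..<n}" "vec_index v"]
    by (simp add: cscalar_prod_eq_cinner[OF v(1) v(1)] complex_eq_iff)
  have "(e \<cdot>\<^sub>v v) \<bullet>c (e \<cdot>\<^sub>v v) = of_real ((cmod e)\<^sup>2) * (v \<bullet>c v)"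
    using v(1) by (simp add: scalar_prod_def sum_distrib_left complex_norm_square mult_ac del: of_real_power)
  then have "(cmod e)\<^sup>2 * Re (v \<bullet>c v) \<le> 1 * Re (v \<bullet>c v)"
    using contraction_vec[OF v(1)] by (simp add: v(3) del: of_real_power)
  then have "(cmod e)\<^sup>2 \<le> 1" using pos by (simp only: mult_le_cancel_right_pos)
  then have "cmod e \<le> 1" by (simp add: abs_square_le_1)
  moreover have "cmod e \<noteq> 1"
    using unimodular_eigenvalue_imp_not_completely_nonunitary[OF A contraction_vec e(1)] cnu by blast
  ultimately show ?thesis using e(2) by simp
qed

text \<open>Powers of a matrix of spectral radius below 1 have bounded entries. Applying this to
  A/r, with \<open>r\<close> between the spectral radius and 1, leaves a factor r^k for the
  decay.\<close>

lemma apply_fst_power_tendsto_0: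
  assumes A: "A \<in> carrier_mat n n" and n: "0 < n" and sr: "spectral_radius A < 1"
  shows "(\<lambda>k. Re (cinner (grid n m) ((apply_fst n (entries A) ^^ k) x) ((apply_fst n (entries A) ^^ k) x))) \<longlonglongrightarrow> 0"
proof -
  \<comment> \<open>The midpoint is positive even for spectral radius 0, so \<open>A\<close> can be
    divided by it.\<close>
  define r where "r = (1 + spectral_radius A) / 2"
  have "0 \<le> spectral_radius A" using spectral_radius_mem_max(1)[OF A n] by auto
  with sr have r: "0 < r" "r < 1" "spectral_radius A < r" by (simp_all add: r_def)
  define M where "M = of_real (1 / r) \<cdot>\<^sub>m A"
  have M: "M \<in> carrier_mat n n" using A by (simp add: M_def)
  have A_entry: "A $$ (i, l) = of_real r * M $$ (i, l)" if "i < n" "l < n" for i l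
    using that A r by (simp add: M_def)
  have "spectral_radius M < 1"
  proof -
    obtain e where e: "eigenvalue M e" "spectral_radius M = cmod e"
      using spectral_radius_mem_max(1)[OF M n] by (auto simp: spectrum_def)
    then obtain v where v: "v \<in> carrier_vec n" "v \<noteq> 0\<^sub>v n" "M *\<^sub>v v = e \<cdot>\<^sub>v v"
      using M unfolding eigenvalue_def eigenvector_def by auto
    have "A = of_real r \<cdot>\<^sub>m M" using A r by (auto simp: M_def)
    then have "A *\<^sub>v v = of_real r \<cdot>\<^sub>v (M *\<^sub>v v)"
      using M v(1) by (intro eq_vecI) (auto simp: scalar_prod_def sum_distrib_left mult_ac)
    then have "A *\<^sub>v v = (of_real r * e) \<cdot>\<^sub>v v"
      by (simp add: v(3) smult_smult_assoc)
    then have "eigenvalue A (of_real r * e)"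
      using A v(1,2) unfolding eigenvalue_def eigenvector_def by auto
    then have "cmod (of_real r * e) \<le> spectral_radius A"
      using spectral_radius_mem_max(2)[OF A n] by (auto simp: spectrum_def)
    then have "r * cmod e \<le> spectral_radius A" using r(1) by (simp add: norm_mult)
    also have "\<dots> < r * 1" using r(3) by simp
    finally show ?thesis using r(1) e(2) by (simp only: mult_less_cancel_left_pos)
  qed
  then obtain c where c: "\<And>k. norm_bound (M ^\<^sub>m k) c"
    using spectral_radius_jnf_norm_bound_less_1_upper_triangular[OF M] by blast
  have power: "(apply_fst n (entries A) ^^ k) x (i, j) = of_real r ^ k * (\<Sum>l<n. (M ^\<^sub>m k) $$ (i, l) * x (l, j))"
    if i: "i < n" for k i j and x :: "nat \<times> nat \<Rightarrow> complex"
  proof (induction k arbitrary: x)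
    case 0
    have "(\<Sum>l<n. 1\<^sub>m n $$ (i, l) * x (l, j)) = (\<Sum>l<n. if l = i then x (l, j) else 0)"
      using i by (intro sum.cong) auto
    then show ?case using i M by simp
  next
    case (Suc k)
    have step: "apply_fst n (entries A) x (l, j) = (\<Sum>p<n. of_real r * M $$ (l, p) * x (p, j))" if "l < n" for l
      unfolding apply_fst_def mat_apply_def prod.case
      by (intro sum.cong refl arg_cong2[where f = "(*)"] A_entry that) simp
    have dim: "M ^\<^sub>m k \<in> carrier_mat n n" using M by simp
    have "(apply_fst n (entries A) ^^ Suc k) x (i, j) = (apply_fst n (entries A) ^^ k) (apply_fst n (entries A) x) (i, j)"
      by (simp only: funpow_Suc_right o_apply)
    also have "\<dots> = of_real r ^ k * (\<Sum>l<n. (M ^\<^sub>m k) $$ (i, l) * (\<Sum>p<n. of_real r * M $$ (l, p) * x (p, j)))"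
      unfolding Suc.IH by (intro arg_cong2[where f = "(*)"] sum.cong refl) (simp add: step)
    also have "\<dots> = of_real r ^ Suc k * (\<Sum>l<n. \<Sum>p<n. (M ^\<^sub>m k) $$ (i, l) * M $$ (l, p) * x (p, j))"
      by (simp add: sum_distrib_left mult_ac)
    also have "(\<Sum>l<n. \<Sum>p<n. (M ^\<^sub>m k) $$ (i, l) * M $$ (l, p) * x (p, j)) =
      (\<Sum>p<n. \<Sum>l<n. (M ^\<^sub>m k) $$ (i, l) * M $$ (l, p) * x (p, j))"
      by (rule sum.swap)
    also have "\<dots> = (\<Sum>p<n. (M ^\<^sub>m Suc k) $$ (i, p) * x (p, j))"
      using i M dim by (auto simp: scalar_prod_def atLeast0LessThan sum_distrib_right intro!: sum.cong)
    finally show ?case .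
  qed
  have "(\<lambda>k. (apply_fst n (entries A) ^^ k) x p) \<longlonglongrightarrow> 0" if p: "p \<in> grid n m" for p
  proof -
    obtain i j where ij: "p = (i, j)" "i < n" using p by auto
    define K where "K = c * (\<Sum>l<n. cmod (x (l, j)))"
    have bound: "cmod ((apply_fst n (entries A) ^^ k) x p) \<le> K * r ^ k" for k
    proof -
      have "cmod (\<Sum>l<n. (M ^\<^sub>m k) $$ (i, l) * x (l, j)) \<le> K"
        unfolding K_def sum_distrib_left
      proof (rule sum_norm_le)
        fix l assume "l \<in> {..<n}"
        then have "cmod ((M ^\<^sub>m k) $$ (i, l)) \<le> c"
          using c[of k] M ij by (simp add: norm_bound_def)
        then show "cmod ((M ^\<^sub>m k) $$ (i, l) * x (l, j)) \<le> c * cmod (x (l, j))"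
          unfolding norm_mult by (rule mult_right_mono) simp
      qed
      then have "r ^ k * cmod (\<Sum>l<n. (M ^\<^sub>m k) $$ (i, l) * x (l, j)) \<le> r ^ k * K"
        using r by (intro mult_left_mono) auto
      then show ?thesis
        unfolding ij(1) power[OF ij(2)] using r by (simp add: norm_mult norm_power mult.commute)
    qed
    have norm_bound: "norm ((apply_fst n (entries A) ^^ k) x p) \<le> norm (K * r ^ k) * 1" for k
      unfolding real_norm_def mult_1_right by (rule order_trans[OF bound abs_ge_self])
    have "(\<lambda>k. K * r ^ k) \<longlonglongrightarrow> K * 0"
      by (intro tendsto_intros LIMSEQ_power_zero) (use r in simp)
    then have lim: "(\<lambda>k. K * r ^ k) \<longlonglongrightarrow> 0" by simp
    show ?thesis
      by (rule tendsto_0_le[OF lim always_eventually[OF allI[OF norm_bound]]])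
  qed
  then have "(\<lambda>k. \<Sum>p\<in>grid n m. (cmod ((apply_fst n (entries A) ^^ k) x p))\<^sup>2) \<longlonglongrightarrow> (\<Sum>p\<in>grid n m. (cmod 0)\<^sup>2)"
    by (intro tendsto_intros) auto
  then show ?thesis by (simp add: Re_cinner_self)
qed

section \<open>From the pencil to the circle and the disc\<close>

lemma normalized_value_in_numerical_range:
  assumes B: "B \<in> carrier_mat m m" and N: "0 < Re (cinner {..<m} y y)"
    and v: "cinner {..<m} (mat_apply m (entries B) y) y = cinner {..<m} y y * v"
  shows "v \<in> numerical_range B"
proof -
  define r where "r = sqrt (Re (cinner {..<m} y y))"
  have r: "0 < r" "r * r = Re (cinner {..<m} y y)" using N by (simp_all add: r_def)
  have self: "cinner {..<m} y y = of_real (r * r)" unfolding cinner_self_eq_iff r(2) ..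
  define y' where "y' = fscale (of_real (1 / r)) y"
  have "cinner {..<m} y' y' = 1"
    using r(1) by (simp add: y'_def cinner.ip_scale cinner.ip_scale_right self)
  moreover have "cinner {..<m} (mat_apply m (entries B) y') y' = v"
    using r(1) by (simp add: y'_def mat_apply_fscale cinner.ip_scale cinner.ip_scale_right v self)
  ultimately show ?thesis unfolding numerical_range_eq[OF B] by blast
qed

lemma apply_zero [simp]: "apply_fst n a 0 = 0" "apply_snd n a 0 = 0"
  by (auto simp: apply_fst_def apply_snd_def mat_apply_def fun_eq_iff)

lemma apply_snd_diff: "apply_snd m b (x - y) = apply_snd m b x - apply_snd m b y"
  using apply_snd_add[of m b "x - y" y] by (simp add: algebra_simps)

lemma cinner_indicator:
  assumes "finite I" "p \<in> I"
  shows "cinner I x (\<lambda>q. if q = p then 1 else 0) = x p"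
proof -
  have "cinner I x (\<lambda>q. if q = p then 1 else 0) = (\<Sum>q\<in>I. if q = p then x q else 0)"
    unfolding cinner_def by (rule sum.cong) auto
  then show ?thesis using assms by simp
qed

lemma circle_in_numerical_range:
  assumes A: "A \<in> carrier_mat n n" and B: "B \<in> carrier_mat m m" and n: "0 < n" and m: "0 < m"
    and contraction: "\<And>x. Re (cinner {..<n} (mat_apply n (entries A) x) (mat_apply n (entries A) x)) \<le> Re (cinner {..<n} x x)"
    and cnu: "completely_nonunitary A"
    and eq: "numerical_radius (kronecker_product A B) = numerical_radius B"
    and z': "cmod z' = 1"
  shows "of_real (numerical_radius B) * z' \<in> numerical_range B"
proof -
  define w where "w = numerical_radius B"
  obtain xB where "cmod (cinner {..<m} (mat_apply m (entries B) xB) xB) = w"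
    and B_bound: "\<And>y. cmod (cinner {..<m} (mat_apply m (entries B) y) y) \<le> w * Re (cinner {..<m} y y)"
    using numerical_radius_attained[OF B m] unfolding w_def by metis
  then have w: "0 \<le> w" by (metis norm_ge_zero)
  obtain x0 where x0: "cinner {..<n * m} x0 x0 = 1"
    "cmod (cinner {..<n * m} (mat_apply (n * m) (entries (kronecker_product A B)) x0) x0) = w"
    using numerical_radius_attained[OF kronecker_product_carrier[OF A B]] n m
    unfolding eq w_def by (metis nat_0_less_mult_iff)
  define X where "X = (\<lambda>(i, j). x0 (i * m + j))"
  define \<zeta> where "\<zeta> = cinner (grid n m) (apply_fst n (entries A) (apply_snd m (entries B) X)) X"
  have X: "cinner (grid n m) X X = 1" "cmod \<zeta> = w"
    using x0 cinner_kronecker_product[OF A B, of x0] by (simp_all add: X_def \<zeta>_def)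
  obtain c where c: "cmod c = 1" "c * \<zeta> = of_real w"
  proof (cases "\<zeta> = 0")
    case True
    then show ?thesis using that[of 1] X(2) by simp
  next
    case False
    have "cnj \<zeta> * \<zeta> = of_real (w * w)"
      using X(2) complex_norm_square[of \<zeta>] by (simp add: mult.commute power2_eq_square)
    moreover have "w \<noteq> 0" using False X(2) by auto
    ultimately show ?thesis
      using that[of "cnj \<zeta> / of_real w"] X(2) w by (simp add: norm_divide)
  qed
  text \<open>Rotating \<open>B\<close> makes the extremal value real and nonnegative.\<close>
  define b where "b i j = c * entries B i j" for i j
  have mat_apply_b: "mat_apply m b y = fscale c (mat_apply m (entries B) y)" for y
    by (simp add: b_def mat_apply_def fun_eq_iff sum_distrib_left mult_ac)
  have b_bound: "cmod (cinner {..<m} (mat_apply m b y) y) \<le> w * Re (cinner {..<m} y y)" for y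
    using B_bound[of y] c(1) by (simp add: mat_apply_b cinner.ip_scale norm_mult)
  let ?A = "apply_fst n (entries A)" and ?A' = "apply_fst n (adjoint_entries (entries A))"
    and ?B = "apply_snd m b" and ?ip = "cinner (grid n m)"
  interpret C: commuting_contraction fscale ?ip ?A ?A' ?B w
    using contraction b_bound w by (rule commuting_contraction_grid)
  have app_b: "?B x = fscale c (apply_snd m (entries B) x)" for x
    by (simp add: apply_snd_def mat_apply_b fun_eq_iff)
  have extremal: "?ip (?B (?A X)) X = of_real w * ?ip X X"
  proof -
    have "?ip (?B (?A X)) X = c * \<zeta>"
      by (simp add: app_b cinner.ip_scale \<zeta>_def apply_fst_apply_snd)
    then show ?thesis by (simp add: c X)
  qed
  have decay: "(\<lambda>k. Re (?ip ((?A ^^ k) X) ((?A ^^ k) X))) \<longlonglongrightarrow> 0"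
    by (rule apply_fst_power_tendsto_0[OF A n spectral_radius_less_1[OF A n contraction cnu]])
  \<comment> \<open>The defect operator commutes with \<open>?B\<close>, which turns the abstract
    recurrence into one for the vectors \<open>G k\<close>.\<close>
  define D where "D x = x - ?A' (?A x)" for x
  have defect: "C.defect x v = ?ip (D x) v" for x v
    by (simp add: C.defect_def D_def cinner.ip_diff cinner_apply_fst)
  have D_B: "D (?B x) = ?B (D x)" for x
    by (simp add: D_def apply_fst_apply_snd apply_snd_diff)
  define G where "G k = D (C.orbit X k)" for k
  have G0: "G 0 = 0" by (simp add: G_def D_def)
  have rec: "2 * of_real w * G k p = ?B (G (Suc k)) p + apply_snd m (adjoint_entries b) (G (k - 1)) p"
    if p: "p \<in> grid n m" for k p
  proof -
    \<comment> \<open>Pairing with a coordinate vector reads off a single entry.\<close>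
    define v where "v = (\<lambda>q. if q = p then 1 else 0 :: complex)"
    have ip_v: "?ip x v = x p" for x
      unfolding v_def using p by (intro cinner_indicator) auto
    have "2 * of_real w * ?ip (G k) v = ?ip (?B (G (Suc k))) v +
      (if k = 0 then 0 else ?ip (G (k - 1)) (?B v))"
      using C.orbit_recurrence[OF extremal decay, of k v] unfolding defect D_B G_def .
    \<comment> \<open>For \<open>k = 0\<close> the truncated \<open>k - 1\<close> is 0 and
      \<open>G 0 = 0\<close>, so the case distinction disappears.\<close>
    also have "(if k = 0 then 0 else ?ip (G (k - 1)) (?B v)) = ?ip (apply_snd m (adjoint_entries b) (G (k - 1))) v"
      by (simp add: cinner_apply_snd G0)
    finally show ?thesis by (simp only: ip_v)
  qed
  \<comment> \<open>If every \<open>G k\<close> vanished, the norm would stay 1 along the orbit,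
    against the decay.\<close>
  have "\<exists>k0. \<exists>p0\<in>grid n m. G k0 p0 \<noteq> 0"
  proof (rule ccontr)
    assume "\<not> ?thesis"
    then have zero: "G k p = 0" if "p \<in> grid n m" for k p using that by blast
    have step: "?ip (?A x) (?A x) = ?ip x x" if "x = (?A ^^ k) X" for k x
    proof -
      have "C.defect x x = ?ip (G (Suc k)) x" by (simp add: defect G_def that)
      also have "\<dots> = 0" using zero by (simp add: cinner_def)
      finally show ?thesis by (simp add: C.defect_def)
    qed
    have "?ip ((?A ^^ k) X) ((?A ^^ k) X) = 1" for k
    proof (induction k)
      case (Suc k)
      then show ?case using step[OF refl, of k] by simp
    qed (simp add: X)
    with decay have "(\<lambda>k :: nat. 1 :: real) \<longlonglongrightarrow> 0" by simp
    from LIMSEQ_unique[OF this tendsto_const] show False by simp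
  qed
  then obtain k0 p0 where p0: "p0 \<in> grid n m" "G k0 p0 \<noteq> 0" by blast
  obtain i0 j0 where ij: "p0 = (i0, j0)" "i0 < n" "j0 < m" using p0(1) by auto
  \<comment> \<open>The factor \<open>c\<close> compensates for the rotation in \<open>b\<close> and
    cancels at the end.\<close>
  define z where "z = c * z'"
  have z: "cmod z = 1" using c z' by (simp add: z_def norm_mult)
  then have zz: "cnj z * z = 1" using complex_norm_square[of z] by (simp add: mult.commute)
  \<comment> \<open>\<open>I \<otimes> B\<close> acts within rows, so row \<open>i0\<close> of
    \<open>G\<close> satisfies the recurrence by itself.\<close>
  obtain y j where y: "j < m" "y j \<noteq> 0"
    and pencil: "\<And>j. j < m \<Longrightarrow> mat_apply m b y j - 2 * of_real w * z * y j + z\<^sup>2 * mat_apply m (adjoint_entries b) y j = 0"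
  proof (rule singular_pencil_of_recurrence[where r = "\<lambda>k j. G k (i0, j)" and b = b
        and c = "2 * of_real w" and z = z])
    show "G 0 (i0, j) = 0" for j by (simp add: G0)
    show "G k0 (i0, j0) \<noteq> 0" using p0(2) ij by simp
    show "2 * of_real w * G k (i0, j) = mat_apply m b (\<lambda>j. G (Suc k) (i0, j)) j +
      mat_apply m (adjoint_entries b) (\<lambda>j. G (k - 1) (i0, j)) j" if "j < m" for k j
      using rec[of "(i0, j)" k] that ij by (simp add: apply_snd_def)
  qed (use ij that in blast)+
  let ?ipm = "cinner {..<m}"
  define N where "N = Re (?ipm y y)"
  have N: "0 < N"
  proof -
    have "0 < (cmod (y j))\<^sup>2" using y by simp
    also have "\<dots> \<le> N" unfolding N_def Re_cinner_self using y by (intro member_le_sum) auto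
    finally show ?thesis .
  qed
  have ipN: "?ipm y y = of_real N" unfolding cinner_self_eq_iff N_def ..
  define u where "u = ?ipm (mat_apply m b y) y"
  have "?ipm (mat_apply m (adjoint_entries b) y) y = cnj u"
    unfolding u_def cinner_mat_apply[of m "adjoint_entries b"] adjoint_adjoint_entries cinner.ip_cnj ..
  moreover have "?ipm (mat_apply m b y - fscale (2 * of_real w * z) y + fscale (z\<^sup>2) (mat_apply m (adjoint_entries b) y)) y = 0"
    unfolding cinner_def using pencil by (intro sum.neutral) (simp add: mult.assoc)
  ultimately have "u - 2 * of_real w * z * of_real N + z\<^sup>2 * cnj u = 0"
    by (simp add: cinner.ip_add cinner.ip_diff cinner.ip_scale u_def ipN)
  \<comment> \<open>Multiplying the paired equation by \<open>cnj z\<close> exposes a real part: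
    \<open>Re (cnj z * u) = w * N\<close>. The numerical bound on the modulus then leaves no room
    for an imaginary part.\<close>
  then have "cnj z * (u - 2 * of_real w * z * of_real N + z\<^sup>2 * cnj u) = 0" by simp
  then have "cnj z * u - 2 * of_real w * (cnj z * z) * of_real N + (cnj z * z) * z * cnj u = 0"
    by (simp only: distrib_left right_diff_distrib power2_eq_square mult_ac)
  then have "cnj z * u + cnj (cnj z * u) = of_real (2 * (w * N))"
    unfolding zz by (simp add: algebra_simps)
  then have "Re (cnj z * u) = w * N"
    unfolding complex_add_cnj by (simp only: of_real_eq_iff)
  moreover have "cmod (cnj z * u) \<le> w * N"
    using b_bound[of y] z by (simp add: norm_mult u_def N_def)
  ultimately have "(cmod (cnj z * u))\<^sup>2 \<le> (Re (cnj z * u))\<^sup>2"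
    by (intro power_mono) auto
  then have "Im (cnj z * u) = 0" unfolding cmod_power2 by simp
  with \<open>Re (cnj z * u) = w * N\<close> have "cnj z * u = of_real (w * N)"
    by (simp only: complex_eq_iff Re_complex_of_real Im_complex_of_real)
  then have "(cnj z * z) * u = of_real N * (of_real w * z)"
    by (simp add: mult_ac)
  then have "u = ?ipm y y * (of_real w * z)"
    unfolding zz ipN by simp
  then have "c * ?ipm (mat_apply m (entries B) y) y = c * (?ipm y y * (of_real w * z'))"
    by (simp add: u_def mat_apply_b cinner.ip_scale z_def mult_ac)
  moreover have "c \<noteq> 0" using c(1) by auto
  ultimately have "?ipm (mat_apply m (entries B) y) y = ?ipm y y * (of_real w * z')"
    by simp
  with N show ?thesis
    unfolding w_def N_def by (intro normalized_value_in_numerical_range[OF B])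
qed

text \<open>Convexity fills every diameter between opposite points of the circle, and the numerical
  radius excludes everything outside.\<close>

lemma disc_of_circle:
  assumes B: "B \<in> carrier_mat m m" and m: "0 < m"
    and circle: "\<And>z. cmod z = 1 \<Longrightarrow> of_real (numerical_radius B) * z \<in> numerical_range B"
  shows "circular_disc_at_origin (numerical_range B)"
proof -
  define w where "w = numerical_radius B"
  obtain xB where xB: "cmod (cinner {..<m} (mat_apply m (entries B) xB) xB) = w"
    and B_bound: "\<And>y. cmod (cinner {..<m} (mat_apply m (entries B) y) y) \<le> w * Re (cinner {..<m} y y)"
    using numerical_radius_attained[OF B m] unfolding w_def by metis
  have w: "0 \<le> w" using norm_ge_zero[of "cinner {..<m} (mat_apply m (entries B) xB) xB"] xB by simp
  have "numerical_range B \<subseteq> {z. cmod z \<le> w}"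
  proof
    fix z assume "z \<in> numerical_range B"
    then obtain y where "z = cinner {..<m} (mat_apply m (entries B) y) y" "cinner {..<m} y y = 1"
      unfolding numerical_range_eq[OF B] by blast
    then show "z \<in> {z. cmod z \<le> w}" using B_bound[of y] by simp
  qed
  moreover have "p \<in> numerical_range B" if p: "cmod p \<le> w" for p
  proof (cases "w = 0")
    case True
    then show ?thesis using p circle[of 1] by (simp add: w_def)
  next
    case False
    define e where "e = (if p = 0 then 1 else sgn p)"
    have e: "cmod e = 1" "p = of_real (cmod p) * e"
      by (auto simp: e_def norm_sgn) (simp add: sgn_div_norm scaleR_conv_of_real)
    obtain x y where x: "cinner {..<m} x x = 1" "of_real w * e = cinner {..<m} (mat_apply m (entries B) x) x"
      and y: "cinner {..<m} y y = 1" "of_real w * (- e) = cinner {..<m} (mat_apply m (entries B) y) y"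
      using circle[of e] circle[of "- e"] e(1) unfolding numerical_range_eq[OF B] w_def by auto
    \<comment> \<open>\<open>t\<close> solves \<open>(1 - 2 * t) * w = cmod p\<close>, placing
      \<open>p\<close> on the diameter from \<open>w * e\<close> to \<open>- w * e\<close>.\<close>
    define t where "t = (1 - cmod p / w) / 2"
    have t: "0 \<le> t" "t \<le> 1" using p w False by (auto simp: t_def field_simps)
    obtain z where z: "cinner {..<m} z z = 1"
      "cinner {..<m} (mat_apply m (entries B) z) z = of_real (1 - t) * (of_real w * e) + of_real t * (of_real w * (- e))"
      using cinner.toeplitz_hausdorff[where B = "mat_apply m (entries B)", OF mat_apply_add mat_apply_fscale x(1) y(1) t] unfolding x(2) y(2) by metis
    have "of_real (1 - t) * (of_real w * e) + of_real t * (of_real w * (- e)) = of_real ((1 - 2 * t) * w) * e"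
      by (simp add: algebra_simps)
    also have "(1 - 2 * t) * w = cmod p" using False by (simp add: t_def field_simps)
    also have "of_real (cmod p) * e = p" using e(2) by simp
    finally show ?thesis using z unfolding numerical_range_eq[OF B] by force
  qed
  ultimately have "numerical_range B = {z. cmod z \<le> w}" by blast
  with w show ?thesis unfolding circular_disc_at_origin_def by blast
qed

theorem theorem2p2:
  fixes A B :: "complex mat" and n m :: nat
  assumes "n \<ge> 1" and "m \<ge> 1"
    and "A \<in> carrier_mat n n" and "B \<in> carrier_mat m m"
    and "operator_norm A = 1"
    and "numerical_radius (kronecker_product A B) = numerical_radius B"
  shows "has_unitary_part A \<or>
    (completely_nonunitary A \<and> circular_disc_at_origin (numerical_range B))"
proof (cases "completely_nonunitary A")
  case True
  have n: "0 < n" and m: "0 < m" using assms(1,2) by simp_all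
  have "Re (cinner {..<n} (mat_apply n (entries A) x) (mat_apply n (entries A) x)) \<le> Re (cinner {..<n} x x)" for x
    using operator_norm_bound[OF assms(3) n, of x] assms(5) by simp
  then have "of_real (numerical_radius B) * z \<in> numerical_range B" if "cmod z = 1" for z
    using circle_in_numerical_range[OF assms(3,4) n m _ True assms(6) that] by blast
  then show ?thesis using True disc_of_circle[OF assms(4) m] by blast
next
  case False
  then show ?thesis using has_unitary_part_or_completely_nonunitary by blast
qed

end
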